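(* Let $G$ be a connected undirected graph with $N_0$ vertices and $E_0$ edges. For $n\ge 2$ let $\tau_n(G)$ be the $n$-polygon graph of $G$, and for $g\ge 1$ let $\tau_n^g(G)$ be the iterated $n$-polygon graph of $G$ with generation $g$. Let $Kf'(\cdot)$ denote the multiplicative degree-Kirchhoff index. Then for any $n\ge 2$, $$Kf'(\tau_n(G))=(n^2+n)\,Kf'(G)+\frac{2}{3}(n+1)(n^2-1)E_0^2-\frac{2}{3}(n^2-1)E_0N_0-\frac{1}{3}(n^2-1)(n-2)E_0,$$ and for any $n\ge 2$ and $g\ge 1$, $$Kf'(\tau_n^g(G))=(n^2+n)^g\,Kf'(G)-\frac{1}{3}(n-2)(n+1)^g(n^g-1)E_0+\frac{2(n-1)}{3n}(n+1)^g\left[(n+1)^g(n^2+1)-n^{g+2}-1\right]E_0^2-\frac{2}{3}(n+1)^g(n^g-1)E_0N_0.$$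
   Context: Graphs are finite, simple and undirected; $G$ has at least one edge. For a connected graph $H$ with at least one edge, adjacency matrix $A(H)$ and diagonal degree matrix $D(H)$, the normalized Laplacian is $\mathcal{L}_H=I-D(H)^{-1/2}A(H)D(H)^{-1/2}$, with eigenvalues $0=\lambda_1<\lambda_2\le\dots\le\lambda_{N}$, where $N=|V(H)|$. The multiplicative degree-Kirchhoff index of $H$ is given by $Kf'(H)=2|E(H)|\sum_{i=2}^{N}\frac{1}{\lambda_i}$. For $n\ge 2$, the $n$-polygon graph $\tau_n(G)$ is obtained from $G$ by adding, for each edge $ij$ of $G$, a new path of length $n$ (with $n-1$ new internal vertices) joining $i$ and $j$, while keeping the edge $ij$. The iterated graphs are $\tau_n^0(G)=G$ and $\tau_n^g(G)=\tau_n(\tau_n^{g-1}(G))$ for $g\ge 1$. *)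

theory Defs
  imports "Graph_Theory.Graph_Theory" "Jordan_Normal_Form.Char_Poly"
begin

text \<open>
  A finite simple undirected graph is a \<^locale>\<open>pair_graph\<close>: every edge is present as two opposite
  arcs. Undirected edges are therefore counted as two-element sets.
\<close>

definition edge_set :: "'a pair_pre_digraph \<Rightarrow> 'a set set" where
  "edge_set H = (\<lambda>(u, v). {u, v}) ` parcs H"

text \<open>
  Matrices are indexed by positions in an arbitrary enumeration of the vertices; another enumeration
  conjugates them by a permutation matrix and leaves the spectrum unchanged.
\<close>

definition vertex_list :: "'a pair_pre_digraph \<Rightarrow> 'a list" where
  "vertex_list H = (SOME vs. distinct vs \<and> set vs = pverts H)"

definition adjacency_mat :: "'a pair_pre_digraph \<Rightarrow> real mat" where
  "adjacency_mat H = mat (card (pverts H)) (card (pverts H))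
     (\<lambda>(i, j). if (vertex_list H ! i, vertex_list H ! j) \<in> parcs H then 1 else 0)"

text \<open>The matrix \<open>D(H)\<close> raised to the power \<open>-1/2\<close>.\<close>

definition degree_inv_sqrt_mat :: "'a pair_pre_digraph \<Rightarrow> real mat" where
  "degree_inv_sqrt_mat H = mat (card (pverts H)) (card (pverts H))
     (\<lambda>(i, j). if i = j then 1 / sqrt (real (out_degree (with_proj H) (vertex_list H ! i))) else 0)"

definition normalized_laplacian :: "'a pair_pre_digraph \<Rightarrow> real mat" where
  "normalized_laplacian H = 1\<^sub>m (card (pverts H)) -
     degree_inv_sqrt_mat H * adjacency_mat H * degree_inv_sqrt_mat H"

text \<open>The eigenvalues in increasing order, repeated according to multiplicity.\<close>

definition laplacian_eigenvalues :: "'a pair_pre_digraph \<Rightarrow> real list" where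
  "laplacian_eigenvalues H = sorted_list_of_multiset (proots (char_poly (normalized_laplacian H)))"

text \<open>List positions start at 0, so the eigenvalue with index \<open>i\<close> is at position \<open>i - 1\<close>.\<close>

definition degree_kirchhoff_index :: "'a pair_pre_digraph \<Rightarrow> real" where
  "degree_kirchhoff_index H =
     2 * real (card (edge_set H)) *
     (\<Sum>i = 2..card (pverts H). 1 / (laplacian_eigenvalues H ! (i - 1)))"

text \<open>
  One vertex type closed under the construction: \<open>Base\<close> embeds the vertices of the initial graph.
  In one construction step \<open>Old\<close> relabels the vertices already there and \<open>New u v k\<close>
  is the \<open>k\<close>-th internal vertex of the path added along the edge \<open>uv\<close>, so new vertices
  can never clash with old ones.
\<close>

datatype 'a pvert = Base 'a | Old "'a pvert" | New "'a pvert" "'a pvert" nat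

definition base_graph :: "'a pair_pre_digraph \<Rightarrow> 'a pvert pair_pre_digraph" where
  "base_graph G = \<lparr> pverts = Base ` pverts G, parcs = map_prod Base Base ` parcs G \<rparr>"

text \<open>
  One of the two arcs of every edge, so that each edge receives one path and not two. The choice
  depends only on the set of the two arcs; which of them is chosen does not matter up to isomorphism.
\<close>

definition oriented_edges :: "'a pair_pre_digraph \<Rightarrow> ('a \<times> 'a) set" where
  "oriented_edges G = {(u, v) \<in> parcs G. (u, v) = (SOME a. a \<in> {(u, v), (v, u)})}"

lemma (in pair_graph) oriented_edges_unique:
  assumes "(u, v) \<in> parcs G"
  shows "((u, v) \<in> oriented_edges G) \<noteq> ((v, u) \<in> oriented_edges G)"
proof -
  define a where "a = (SOME a. a \<in> {(u, v), (v, u)})"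
  have a: "a \<in> {(u, v), (v, u)}"
    unfolding a_def by (rule someI[of _ "(u, v)"]) simp
  have "u \<noteq> v" "(v, u) \<in> parcs G"
    using assms no_loops' arcs_symmetric by auto
  moreover have "(u, v) \<in> oriented_edges G \<longleftrightarrow> (u, v) \<in> parcs G \<and> (u, v) = a"
    "(v, u) \<in> oriented_edges G \<longleftrightarrow> (v, u) \<in> parcs G \<and> (v, u) = a"
    unfolding oriented_edges_def a_def by (simp_all only: insert_commute mem_Collect_eq case_prod_conv)
  ultimately show ?thesis
    using a assms by auto
qed

definition path_vertex :: "nat \<Rightarrow> 'a pvert \<Rightarrow> 'a pvert \<Rightarrow> nat \<Rightarrow> 'a pvert" where
  "path_vertex n u v k = (if k = 0 then Old u else if k = n then Old v else New u v k)"

definition polygon_step :: "nat \<Rightarrow> 'a pvert pair_pre_digraph \<Rightarrow> 'a pvert pair_pre_digraph" where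
  "polygon_step n G =
     \<lparr> pverts = Old ` pverts G \<union>
         {New u v k | u v k. (u, v) \<in> oriented_edges G \<and> 0 < k \<and> k < n},
       parcs = map_prod Old Old ` parcs G \<union>
         {(path_vertex n u v k, path_vertex n u v (Suc k)) | u v k.
            (u, v) \<in> oriented_edges G \<and> k < n} \<union>
         {(path_vertex n u v (Suc k), path_vertex n u v k) | u v k.
            (u, v) \<in> oriented_edges G \<and> k < n} \<rparr>"

definition iterated_polygon_graph ::
    "nat \<Rightarrow> nat \<Rightarrow> 'a pair_pre_digraph \<Rightarrow> 'a pvert pair_pre_digraph" where
  "iterated_polygon_graph n g G = (polygon_step n ^^ g) (base_graph G)"

definition polygon_graph :: "nat \<Rightarrow> 'a pair_pre_digraph \<Rightarrow> 'a pvert pair_pre_digraph" where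
  "polygon_graph n G = polygon_step n (base_graph G)"

end

theory Submission
  imports Defs "Jordan_Normal_Form.Schur_Decomposition"
begin

text \<open>
  The spectra of \<open>G\<close> and \<open>\<tau>\<^sub>n(G)\<close> are never compared. Read a graph as an electrical network with a
  unit conductor on every edge, and let \<open>g(i, j)\<close> be a Green function: the potential at \<open>i\<close> when a unit
  current enters at \<open>j\<close> and leaves at a fixed root. The proof rests on two facts.

  First, the Kirchhoff index is a simple expression in any such \<open>g\<close>. With \<open>d\<close> for degrees and \<open>E\<close> for
  the number of edges,
  \<open>Kf' = 2 E \<Sum>\<^sub>i d\<^sub>i g(i, i) - \<Sum>\<^sub>i \<Sum>\<^sub>j d\<^sub>i d\<^sub>j g(i, j)\<close>
  (\<open>degree_kirchhoff_index_eq_kirchhoff_sum\<close>). The reason is that \<open>\<Sum> 1 / \<lambda>\<^sub>i\<close> over the nonzero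
  eigenvalues is the trace of a generalized inverse of the normalized Laplacian, and scaling \<open>g\<close> by the
  square roots of the degrees, after centring each row, gives such an inverse. The linear algebra behind
  it is \<open>sum_inverse_nonzero_eigenvalues\<close>.

  Secondly, a Green function of \<open>G\<close> gives one of \<open>\<tau>\<^sub>n(G)\<close> explicitly (\<open>green_kernel_polygon_step\<close>).
  Between the old ends of an edge the new path adds a conductor \<open>1/n\<close> parallel to the old one, so the old
  potentials are scaled by \<open>n / (n + 1)\<close>. Along a path they are interpolated linearly, and if both
  arguments lie inside the same path, the Green function of a segment with grounded ends is added.

  Substituting the second fact in the first leaves sums of quadratic polynomials along each path
  (\<open>trapezoid_sum_quadratic\<close>). The only further quantity that appears, the sum of \<open>g(u, v)\<close> over
  adjacent pairs, is evaluated by Foster's theorem (\<open>foster_sum\<close>) and brings in the number of vertices.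
  The result is the recursion \<open>kirchhoff_sum_polygon_step\<close>. Since \<open>\<tau>\<^sub>n\<close> multiplies \<open>E\<close> by \<open>n + 1\<close> and adds
  \<open>(n - 1) E\<close> vertices, the formula for \<open>g\<close> generations follows by induction, and the first formula of
  the theorem is the case of one generation.
\<close>

section \<open>Reciprocals of the nonzero eigenvalues of a symmetric matrix\<close>

lemma trace_mult_commute:
  fixes A B :: "'a::comm_semiring_0 mat"
  assumes "A \<in> carrier_mat n m" "B \<in> carrier_mat m n"
  shows "(\<Sum>i<n. (A * B) $$ (i, i)) = (\<Sum>i<m. (B * A) $$ (i, i))"
proof -
  have "(\<Sum>i<n. (A * B) $$ (i, i)) = (\<Sum>i<n. \<Sum>k<m. A $$ (i, k) * B $$ (k, i))"
    using assms by (intro sum.cong) (auto simp: scalar_prod_def lessThan_atLeast0)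
  also have "\<dots> = (\<Sum>k<m. \<Sum>i<n. B $$ (k, i) * A $$ (i, k))"
    by (subst sum.swap) (simp add: mult.commute)
  also have "\<dots> = (\<Sum>i<m. (B * A) $$ (i, i))"
    using assms by (intro sum.cong) (auto simp: scalar_prod_def lessThan_atLeast0)
  finally show ?thesis .
qed

lemma symmetric_eigenvalue_real:
  fixes A :: "real mat"
  assumes A: "A \<in> carrier_mat n n" and sym: "\<And>i j. i < n \<Longrightarrow> j < n \<Longrightarrow> A $$ (i, j) = A $$ (j, i)"
    and ev: "eigenvalue (map_mat complex_of_real A) z"
  shows "z \<in> \<real>"
proof -
  let ?C = "map_mat complex_of_real A"
  obtain v where v: "v \<in> carrier_vec n" "v \<noteq> 0\<^sub>v n" "?C *\<^sub>v v = z \<cdot>\<^sub>v v"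
    using ev A unfolding eigenvalue_def eigenvector_def by auto
  have row: "(\<Sum>j<n. complex_of_real (A $$ (i, j)) * v $ j) = z * v $ i" if "i < n" for i
    using arg_cong[OF v(3), of "\<lambda>x. x $ i"] that A v(1)
    by (simp add: scalar_prod_def lessThan_atLeast0)
  define q where "q = (\<Sum>i<n. \<Sum>j<n. cnj (v $ i) * (complex_of_real (A $$ (i, j)) * v $ j))"
  define s where "s = (\<Sum>i<n. (cmod (v $ i))\<^sup>2)"
  have "q = (\<Sum>i<n. cnj (v $ i) * (z * v $ i))"
    unfolding q_def by (intro sum.cong) (simp_all add: row flip: sum_distrib_left)
  also have "\<dots> = z * complex_of_real s"
    unfolding s_def of_real_sum sum_distrib_left
    by (intro sum.cong) (simp_all add: complex_norm_square ac_simps del: of_real_power)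
  finally have q: "q = z * complex_of_real s" .
  have "cnj q = (\<Sum>i<n. \<Sum>j<n. cnj (v $ j) * (complex_of_real (A $$ (j, i)) * v $ i))"
    unfolding q_def cnj_sum by (intro sum.cong) (auto simp: sym ac_simps)
  also have "\<dots> = q" unfolding q_def by (rule sum.swap)
  finally have "q \<in> \<real>" by (simp add: complex_is_Real_iff complex_eq_iff)
  moreover have "s > 0"
  proof -
    obtain i where "i < n" "v $ i \<noteq> 0"
      using v(1,2) by (metis carrier_vecD eq_vecI index_zero_vec(1,2))
    then show ?thesis unfolding s_def by (intro sum_pos2[of _ i]) auto
  qed
  moreover have "z = q / complex_of_real s" using q \<open>s > 0\<close> by simp
  ultimately show ?thesis by (metis Reals_divide Reals_of_real)
qed

text \<open>
  The complex roots are real, so the factorization over the complex numbers descends to the reals.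
\<close>

lemma char_poly_symmetric_splits:
  fixes A :: "real mat"
  assumes A: "A \<in> carrier_mat n n" and sym: "\<And>i j. i < n \<Longrightarrow> j < n \<Longrightarrow> A $$ (i, j) = A $$ (j, i)"
  defines "es \<equiv> sorted_list_of_multiset (proots (char_poly A))"
  shows "char_poly A = (\<Prod>e\<leftarrow>es. [:- e, 1:])" and "length es = n"
proof -
  let ?C = "map_mat complex_of_real A"
  have C: "?C \<in> carrier_mat n n" using A by simp
  obtain as where as: "char_poly ?C = (\<Prod>a\<leftarrow>as. [:- a, 1:])" "length as = n"
    using char_poly_factorized[OF C] by auto
  have real: "complex_of_real (Re a) = a" if "a \<in> set as" for a
  proof -
    have "poly (char_poly ?C) a = 0"
      using that by (simp add: as(1) poly_prod_list prod_list_zero_iff image_iff) force?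
    then have "eigenvalue ?C a" using eigenvalue_root_char_poly[OF C] by simp
    then show ?thesis using symmetric_eigenvalue_real[OF A sym] by (simp add: of_real_Re)
  qed
  interpret of_real: map_poly_inj_idom_hom complex_of_real ..
  have hom: "map_poly complex_of_real (\<Prod>r\<leftarrow>rs. [:- r, 1:]) = (\<Prod>r\<leftarrow>rs. [:- complex_of_real r, 1:])" for rs
    by (induction rs) (simp_all add: of_real.hom_mult del: mult_pCons_left)
  have "map_poly complex_of_real (\<Prod>r\<leftarrow>map Re as. [:- r, 1:]) = (\<Prod>a\<leftarrow>as. [:- complex_of_real (Re a), 1:])"
    using hom[of "map Re as"] by (simp add: comp_def)
  also have "\<dots> = (\<Prod>a\<leftarrow>as. [:- a, 1:])"
    using real by (intro arg_cong[where f = prod_list] map_cong) auto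
  also have "\<dots> = map_poly complex_of_real (char_poly A)"
    unfolding as(1)[symmetric] by (rule of_real_hom.char_poly_hom[OF A])
  finally have cp: "char_poly A = (\<Prod>r\<leftarrow>map Re as. [:- r, 1:])"
    by (simp add: of_real.injectivity)
  have "proots (\<Prod>r\<leftarrow>rs. [:- r, 1:]) = mset rs" for rs :: "real list"
  proof (induction rs)
    case (Cons r rs)
    have "(\<Prod>r\<leftarrow>rs. [:- r, 1:]) \<noteq> 0" by (auto simp: prod_list_zero_iff)
    then show ?case using Cons by (simp add: proots_mult del: mult_pCons_left)
  qed simp
  then have roots: "proots (char_poly A) = mset (map Re as)" by (simp only: cp)
  then have es: "mset es = mset (map Re as)" by (simp add: es_def)
  then show "length es = n" using as(2) by (metis length_map mset_eq_length)
  show "char_poly A = (\<Prod>e\<leftarrow>es. [:- e, 1:])"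
    unfolding cp by (metis (no_types, lifting) es mset_map prod_mset_prod_list)
qed

text \<open>
  Row and column \<open>0\<close> are left out because the matrix at hand is a triangular form of a singular one:
  only the block complementary to the kernel is inverted. Working upwards from the last row, each row of
  the equation \<open>B Y = 1\<close> shows that the diagonal entry of \<open>B\<close> is invertible and then that the entries of
  \<open>Y\<close> to the left of the diagonal vanish, which is what the next row needs.
\<close>

lemma upper_triangular_inverse_diag:
  fixes B Y :: "'a::field mat"
  assumes B: "B \<in> carrier_mat n n" and Y: "Y \<in> carrier_mat n n" and ut: "upper_triangular B"
    and BY: "\<And>i j. 0 < i \<Longrightarrow> i < n \<Longrightarrow> j < n \<Longrightarrow> 0 < j \<Longrightarrow> (B * Y) $$ (i, j) = (if i = j then 1 else 0)"
    and i: "0 < i" "i < n"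
  shows "B $$ (i, i) * Y $$ (i, i) = 1"
proof -
  have "B $$ (i, i) * Y $$ (i, i) = 1 \<and> (\<forall>j. 0 < j \<and> j < i \<longrightarrow> Y $$ (i, j) = 0)"
    using i
  proof (induction "n - i" arbitrary: i rule: less_induct)
    case less
    have prod: "B $$ (i, i) * Y $$ (i, j) = (if i = j then 1 else 0)" if j: "0 < j" "j \<le> i" for j
    proof -
      have "(if i = j then 1 else 0) = (\<Sum>k<n. B $$ (i, k) * Y $$ (k, j))"
        using BY[of i j] less.prems j B Y by (simp add: scalar_prod_def lessThan_atLeast0)
      also have "\<dots> = (\<Sum>k\<in>{i}. B $$ (i, k) * Y $$ (k, j))"
      proof (rule sum.mono_neutral_right)
        show "\<forall>k\<in>{..<n} - {i}. B $$ (i, k) * Y $$ (k, j) = 0"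
        proof
          fix k assume k: "k \<in> {..<n} - {i}"
          show "B $$ (i, k) * Y $$ (k, j) = 0"
          proof (cases "k < i")
            case True
            then show ?thesis using upper_triangularD[OF ut True] less.prems B by simp
          next
            case False
            then show ?thesis using less.hyps[of k] k less.prems j by auto
          qed
        qed
      qed (use less.prems in auto)
      finally show ?thesis by simp
    qed
    have d: "B $$ (i, i) * Y $$ (i, i) = 1" using prod[of i] less.prems by simp
    moreover have "Y $$ (i, j) = 0" if "0 < j" "j < i" for j
      using prod[of j] that d by auto
    ultimately show ?case by blast
  qed
  then show ?thesis ..
qed

text \<open>
  The matrix \<open>X\<close> inverts \<open>A\<close> up to a matrix whose columns are multiples of the kernel vector \<open>w\<close>, and
  it annihilates \<open>w\<close>. In a basis that triangularizes \<open>A\<close> with the eigenvalue \<open>0\<close> first, the first basis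
  vector is proportional to \<open>w\<close>. Hence the correction disappears from all rows but the first, and the
  corner entry of the transformed \<open>X\<close> is \<open>0\<close>. The remaining diagonal entries are the reciprocals of
  the other eigenvalues, and the trace does not depend on the basis. Positive semidefiniteness
  ensures that \<open>0\<close> is the first entry of the sorted list.
\<close>

lemma sum_inverse_nonzero_eigenvalues:
  fixes A X :: "real mat" and w u :: "real vec"
  assumes A: "A \<in> carrier_mat n n" and X: "X \<in> carrier_mat n n"
    and w: "w \<in> carrier_vec n" "w \<noteq> 0\<^sub>v n" and u: "u \<in> carrier_vec n"
    and sym: "\<And>i j. i < n \<Longrightarrow> j < n \<Longrightarrow> A $$ (i, j) = A $$ (j, i)"
    and psd: "\<And>v. v \<in> carrier_vec n \<Longrightarrow> v \<bullet> (A *\<^sub>v v) \<ge> 0"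
    and Aw: "A *\<^sub>v w = 0\<^sub>v n"
    and ker: "\<And>v. v \<in> carrier_vec n \<Longrightarrow> A *\<^sub>v v = 0\<^sub>v n \<Longrightarrow> \<exists>c. v = c \<cdot>\<^sub>v w"
    and AX: "A * X = 1\<^sub>m n - mat n n (\<lambda>(i, j). w $ i * u $ j)"
    and Xw: "X *\<^sub>v w = 0\<^sub>v n"
  shows "(\<Sum>i = 2..n. 1 / (sorted_list_of_multiset (proots (char_poly A)) ! (i - 1))) = (\<Sum>i<n. X $$ (i, i))"
proof -
  define es where "es = sorted_list_of_multiset (proots (char_poly A))"
  have cp: "char_poly A = (\<Prod>e\<leftarrow>es. [:- e, 1:])" and len: "length es = n"
    using char_poly_symmetric_splits[OF A sym] by (simp_all add: es_def)
  have n: "n > 0" using w by (metis carrier_vecD eq_vecI gr_zeroI index_zero_vec(2) less_nat_zero_code)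
  have ev_iff: "e \<in> set es \<longleftrightarrow> eigenvalue A e" for e
    unfolding eigenvalue_root_char_poly[OF A] cp by (auto simp: poly_prod_list prod_list_zero_iff image_iff)
  have nonneg: "e \<ge> 0" if mem: "e \<in> set es" for e
  proof -
    obtain v where v: "v \<in> carrier_vec n" "v \<noteq> 0\<^sub>v n" "A *\<^sub>v v = e \<cdot>\<^sub>v v"
      using mem A unfolding ev_iff eigenvalue_def eigenvector_def by auto
    have "v \<bullet> v \<noteq> 0" "v \<bullet> v \<ge> 0"
      using v(1,2) conjugate_square_eq_0_vec[OF v(1)] conjugate_square_ge_0_vec[of v] by auto
    moreover have "e * (v \<bullet> v) \<ge> 0"
      using psd[OF v(1)] v by simp
    ultimately show ?thesis by (simp add: zero_le_mult_iff)
  qed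
  have "0 \<in> set es"
    unfolding ev_iff eigenvalue_def eigenvector_def using w Aw A by (intro exI[of _ w]) auto
  then obtain i where i: "i < n" "es ! i = 0" using len by (metis in_set_conv_nth)
  have "sorted es" by (simp add: es_def)
  then have "es ! 0 \<le> es ! i" using i len by (intro sorted_nth_mono) auto
  moreover have "es ! 0 \<ge> 0" using nonneg[of "es ! 0"] len n by simp
  ultimately have es0: "es ! 0 = 0" using i(2) by linarith
  \<comment> \<open>The order of \<open>es\<close> is the order of the diagonal, so the eigenvalue \<open>0\<close> occupies the corner.\<close>
  obtain B P Q where "schur_decomposition A es = (B, P, Q)" by (cases "schur_decomposition A es")
  from schur_decomposition[OF A cp this]
  have wit: "similar_mat_wit A B P Q" and ut: "upper_triangular B" and diag: "diag_mat B = es" by auto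
  note PQ = similar_mat_witD2[OF A wit]
  have Bdiag: "B $$ (i, i) = es ! i" if "i < n" for i
    using that PQ(5) unfolding diag[symmetric] by (simp add: diag_mat_def)
  note cP = PQ(6) and cQ = PQ(7) and cB = PQ(5)
  have AP: "A * P = P * B"
  proof -
    have "A * P = P * B * Q * P" using PQ(3) by simp
    also have "\<dots> = P * B * (Q * P)"
      by (rule assoc_mult_mat[OF mult_carrier_mat[OF cP cB] cQ cP])
    finally show ?thesis using PQ(2) right_mult_one_mat[OF mult_carrier_mat[OF cP cB]] by simp
  qed
  have BQ: "B * Q = Q * A"
  proof -
    have "Q * A = Q * (P * (B * Q))" using PQ(3) assoc_mult_mat[OF cP cB cQ] by simp
    also have "\<dots> = Q * P * (B * Q)"
      by (rule assoc_mult_mat[OF cQ cP mult_carrier_mat[OF cB cQ], symmetric])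
    finally show ?thesis using PQ(2) left_mult_one_mat[OF mult_carrier_mat[OF cB cQ]] by simp
  qed
  have mult_zero: "M *\<^sub>v 0\<^sub>v n = 0\<^sub>v n" if "M \<in> carrier_mat n n" for M :: "real mat"
    using that by (intro eq_vecI) auto
  define e where "e = (unit_vec n 0 :: real vec)"
  have e: "e \<in> carrier_vec n" by (simp add: e_def)
  define p where "p = P *\<^sub>v e"
  have p: "p \<in> carrier_vec n" using mult_mat_vec_carrier[OF cP e] by (simp add: p_def)
  have Qp: "Q *\<^sub>v p = e"
    unfolding p_def using assoc_mult_mat_vec[OF cQ cP e] PQ(2) e by simp
  have "B *\<^sub>v e = 0\<^sub>v n"
  proof (rule eq_vecI)
    fix i assume "i < dim_vec (0\<^sub>v n :: real vec)"
    then have i: "i < n" by simp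
    then have "B $$ (i, 0) = 0"
      using upper_triangularD[OF ut, of 0 i] cB Bdiag[of 0] es0 by (cases "i = 0") auto
    then show "(B *\<^sub>v e) $ i = 0\<^sub>v n $ i"
      using i cB n by (simp add: e_def)
  qed (use cB in auto)
  then have "A *\<^sub>v p = 0\<^sub>v n"
    unfolding p_def using assoc_mult_mat_vec[OF A cP e] assoc_mult_mat_vec[OF cP cB e] AP mult_zero[OF cP]
    by simp
  then obtain c where c: "p = c \<cdot>\<^sub>v w" using ker[OF p] by blast
  have Qw: "c \<cdot>\<^sub>v (Q *\<^sub>v w) = e"
    using Qp mult_mat_vec[OF cQ w(1)] by (simp add: c)
  have c0: "c \<noteq> 0"
  proof
    assume "c = 0"
    then have "e $ 0 = 0" unfolding Qw[symmetric] using cQ n by simp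
    then show False using n by (simp add: e_def)
  qed
  define Y where "Y = Q * X * P"
  have cQX: "Q * X \<in> carrier_mat n n" using cQ X by simp
  have Y: "Y \<in> carrier_mat n n" using cP cQX by (simp add: Y_def)
  have "Y *\<^sub>v e = Q *\<^sub>v (X *\<^sub>v p)"
    unfolding Y_def p_def using assoc_mult_mat_vec[OF cQX cP e] assoc_mult_mat_vec[OF cQ X p]
    by (simp add: p_def)
  also have "X *\<^sub>v p = 0\<^sub>v n" using mult_mat_vec[OF X w(1)] Xw by (auto simp: c)
  also have "Q *\<^sub>v 0\<^sub>v n = 0\<^sub>v n" by (rule mult_zero[OF cQ])
  finally have "(Y *\<^sub>v e) $ 0 = 0" using n by simp
  then have Y0: "Y $$ (0, 0) = 0"
    using Y n by (simp add: e_def)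
  have BY: "(B * Y) $$ (i, j) = (if i = j then 1 else 0)" if ij: "0 < i" "i < n" "j < n" for i j
  proof -
    define W where "W = mat n n (\<lambda>(i, j). w $ i * u $ j)"
    have W: "W \<in> carrier_mat n n" by (simp add: W_def)
    have QW: "Q * W \<in> carrier_mat n n" using cQ W by simp
    have "B * Y = B * (Q * X) * P"
      unfolding Y_def by (rule assoc_mult_mat[OF cB cQX cP, symmetric])
    also have "B * (Q * X) = Q * (A * X)"
      using assoc_mult_mat[OF cB cQ X] assoc_mult_mat[OF cQ A X] BQ by simp
    also have "\<dots> = Q - Q * W"
      unfolding AX W_def[symmetric] using mult_minus_distrib_mat[OF cQ one_carrier_mat W] cQ by simp
    also have "\<dots> * P = Q * P - Q * W * P"
      by (rule minus_mult_distrib_mat[OF cQ QW cP])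
    finally have "(B * Y) $$ (i, j) = (if i = j then 1 else 0) - (Q * W * P) $$ (i, j)"
      using ij PQ(2) cP cQ W by simp
    note BY = this
    have "(Q *\<^sub>v w) $ i = 0"
      using arg_cong[OF Qw, of "\<lambda>x. x $ i"] ij cQ c0 by (simp add: e_def)
    then have "(\<Sum>l<n. Q $$ (i, l) * w $ l) = 0"
      using ij cQ w by (simp add: scalar_prod_def lessThan_atLeast0)
    then have "(Q * W) $$ (i, k) = 0" if "k < n" for k
      using ij that cQ
      by (simp add: W_def scalar_prod_def lessThan_atLeast0 sum_distrib_right[symmetric] flip: mult.assoc)
    then have "row (Q * W) i = 0\<^sub>v n"
      using ij cQ W by (intro eq_vecI) auto
    moreover have "(Q * W * P) $$ (i, j) = row (Q * W) i \<bullet> col P j"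
      using ij cP cQ by (intro index_mult_mat(1)) auto
    ultimately have "(Q * W * P) $$ (i, j) = 0"
      using ij cP by simp
    with BY show ?thesis by simp
  qed
  have inv: "Y $$ (i, i) = 1 / es ! i" if "0 < i" "i < n" for i
  proof -
    have "es ! i * Y $$ (i, i) = 1"
      using upper_triangular_inverse_diag[OF cB Y ut _ that] BY Bdiag[OF that(2)] by simp
    then show ?thesis by (metis inverse_unique inverse_eq_divide)
  qed
  have "(\<Sum>i<n. Y $$ (i, i)) = (\<Sum>i<n. (P * (Q * X)) $$ (i, i))"
    unfolding Y_def by (rule trace_mult_commute[OF cQX cP])
  also have "P * (Q * X) = X"
    using assoc_mult_mat[OF cP cQ X] PQ(1) X by simp
  also have "(\<Sum>i<n. Y $$ (i, i)) = (\<Sum>i\<in>{..<n} - {0}. 1 / es ! i)"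
    using n Y0 by (subst sum.remove[of _ 0]) (auto intro!: sum.cong simp: inv)
  also have "\<dots> = (\<Sum>i = 2..n. 1 / es ! (i - 1))"
    by (rule sum.reindex_bij_witness[of _ "\<lambda>i. i - 1" Suc]) auto
  finally show ?thesis by (simp add: es_def)
qed

section \<open>Arcs, edges and Green functions\<close>

text \<open>
  The Green function with sink \<open>r\<close>: \<open>g a j\<close> is the potential at \<open>a\<close> of a unit current from \<open>j\<close> to
  \<open>r\<close>. The Poisson equation is stated in weak form, as a reproducing property for the Dirichlet
  form, since this form is a sum over arcs and so decomposes along the pieces of a polygon graph. The factor
  \<open>2\<close> is there because every edge is two arcs. For each \<open>j\<close> the potential is determined
  only up to an additive constant, which is left free.
\<close>

definition green_kernel :: "'a pair_pre_digraph \<Rightarrow> 'a \<Rightarrow> ('a \<Rightarrow> 'a \<Rightarrow> real) \<Rightarrow> bool" where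
  "green_kernel H r g \<longleftrightarrow> r \<in> pverts H \<and>
     (\<forall>j\<in>pverts H. \<forall>f. (\<Sum>(a, b)\<in>parcs H. (f a - f b) * (g a j - g b j)) = 2 * (f j - f r))"

text \<open>
  Summing \<open>F a\<close> over all arcs \<open>(a, b)\<close> weights \<open>F a\<close> by the degree of \<open>a\<close>. So this is half the sum of
  \<open>d\<^sub>a d\<^sub>c (g a a + g c c - g a c - g c a)\<close> over all pairs of vertices; for a Green function the bracket
  is the effective resistance between \<open>a\<close> and \<open>c\<close>.
\<close>

definition kirchhoff_sum :: "'a pair_pre_digraph \<Rightarrow> ('a \<Rightarrow> 'a \<Rightarrow> real) \<Rightarrow> real" where
  "kirchhoff_sum H g = real (card (parcs H)) * (\<Sum>(a, b)\<in>parcs H. g a a)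
     - (\<Sum>(a, b)\<in>parcs H. \<Sum>(c, d)\<in>parcs H. g a c)"

lemma (in pair_graph) finite_oriented_edges [simp]: "finite (oriented_edges G)"
  by (rule finite_subset[of _ "parcs G"]) (auto simp: oriented_edges_def)

lemma oriented_edges_subset: "oriented_edges G \<subseteq> parcs G"
  by (auto simp: oriented_edges_def)

lemma (in pair_graph) parcs_eq_oriented:
  "parcs G = oriented_edges G \<union> prod.swap ` oriented_edges G"
  "oriented_edges G \<inter> prod.swap ` oriented_edges G = {}"
proof -
  have "(a, b) \<in> parcs G \<longleftrightarrow> (a, b) \<in> oriented_edges G \<or> (b, a) \<in> oriented_edges G" for a b
    using oriented_edges_unique[of a b] oriented_edges_subset[of G] arcs_symmetric by blast
  then show "parcs G = oriented_edges G \<union> prod.swap ` oriented_edges G"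
    by (auto simp: image_iff) force
  show "oriented_edges G \<inter> prod.swap ` oriented_edges G = {}"
    using oriented_edges_unique oriented_edges_subset[of G] by fastforce
qed

lemma (in pair_graph) sum_parcs_oriented:
  fixes F :: "'a \<Rightarrow> 'a \<Rightarrow> real"
  shows "(\<Sum>(a, b)\<in>parcs G. F a b) = (\<Sum>(u, v)\<in>oriented_edges G. F u v + F v u)"
proof -
  have "(\<Sum>(a, b)\<in>parcs G. F a b)
      = (\<Sum>(a, b)\<in>oriented_edges G. F a b) + (\<Sum>(a, b)\<in>prod.swap ` oriented_edges G. F a b)"
    unfolding parcs_eq_oriented(1)
    by (rule sum.union_disjoint) (simp_all add: parcs_eq_oriented(2))
  also have "(\<Sum>(a, b)\<in>prod.swap ` oriented_edges G. F a b) = (\<Sum>(u, v)\<in>oriented_edges G. F v u)"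
    by (subst sum.reindex) (simp_all add: inj_on_def prod_eq_iff case_prod_beta)
  finally show ?thesis
    by (simp add: sum.distrib case_prod_beta)
qed

lemma (in pair_graph) sum_parcs_swap:
  fixes F :: "'a \<Rightarrow> 'a \<Rightarrow> real"
  shows "(\<Sum>(a, b)\<in>parcs G. F b a) = (\<Sum>(a, b)\<in>parcs G. F a b)"
  unfolding sum_parcs_oriented by (simp add: add.commute)

lemma (in pair_graph) card_parcs_oriented: "card (parcs G) = 2 * card (oriented_edges G)"
  using sum_parcs_oriented[of "\<lambda>_ _. 1"] by simp

lemma (in pair_graph) card_edge_set_oriented: "card (edge_set G) = card (oriented_edges G)"
proof -
  have "edge_set G = (\<lambda>(u, v). {u, v}) ` oriented_edges G"
    unfolding edge_set_def by (subst parcs_eq_oriented(1)) (auto simp: image_Un image_iff insert_commute)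
  moreover have "inj_on (\<lambda>(u, v). {u, v}) (oriented_edges G)"
    using oriented_edges_unique oriented_edges_subset[of G]
    by (fastforce simp: inj_on_def doubleton_eq_iff)
  ultimately show ?thesis by (simp add: card_image)
qed

text \<open>
  Foster's theorem. Test the reproducing property of column \<open>j\<close> with the indicator function of \<open>j\<close> and
  add the equations: every vertex other than the root contributes \<open>2\<close>, the root contributes \<open>0\<close>.
\<close>

lemma (in pair_graph) foster_sum:
  assumes "green_kernel G r g"
  shows "(\<Sum>(a, b)\<in>parcs G. g a b) = (\<Sum>(a, b)\<in>parcs G. g a a) - real (card (pverts G)) + 1"
proof -
  let ?d = "\<lambda>j a. if a = j then 1 else 0 :: real"
  have r: "r \<in> pverts G" using assms by (simp add: green_kernel_def)
  have "(\<Sum>j\<in>pverts G. \<Sum>(a, b)\<in>parcs G. (?d j a - ?d j b) * (g a j - g b j))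
      = (\<Sum>j\<in>pverts G. 2 * (?d j j - ?d j r))"
    using assms by (intro sum.cong) (auto simp: green_kernel_def)
  also have "\<dots> = 2 * real (card (pverts G)) - 2"
    using r pair_finite_verts by (simp add: sum_subtractf sum_distrib_left[symmetric] sum.delta)
  also have "(\<Sum>j\<in>pverts G. \<Sum>(a, b)\<in>parcs G. (?d j a - ?d j b) * (g a j - g b j))
      = (\<Sum>(a, b)\<in>parcs G. (g a a - g b a) - (g a b - g b b))"
  proof (subst sum.swap, rule sum.cong[OF refl], clarify)
    fix a b assume "(a, b) \<in> parcs G"
    then have "a \<in> pverts G" "b \<in> pverts G" by (auto dest: wellformed')
    then show "(\<Sum>j\<in>pverts G. (?d j a - ?d j b) * (g a j - g b j)) = (g a a - g b a) - (g a b - g b b)"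
      using pair_finite_verts by (simp add: left_diff_distrib sum_subtractf if_distrib[of "\<lambda>x. x * _"] sum.delta' cong: if_cong)
  qed
  also have "\<dots> = 2 * (\<Sum>(a, b)\<in>parcs G. g a a) - 2 * (\<Sum>(a, b)\<in>parcs G. g a b)"
    using sum_parcs_swap[of g] sum_parcs_swap[of "\<lambda>a b. g a a"]
    by (simp add: case_prod_beta sum_subtractf sum.distrib algebra_simps)
  finally show ?thesis by simp
qed

section \<open>Vectors and matrices indexed by vertices\<close>

definition vertex_vec :: "'a pair_pre_digraph \<Rightarrow> ('a \<Rightarrow> real) \<Rightarrow> real vec" where
  "vertex_vec H p = vec (card (pverts H)) (\<lambda>i. p (vertex_list H ! i))"

definition vertex_mat :: "'a pair_pre_digraph \<Rightarrow> ('a \<Rightarrow> 'a \<Rightarrow> real) \<Rightarrow> real mat" where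
  "vertex_mat H q = mat (card (pverts H)) (card (pverts H)) (\<lambda>(i, j). q (vertex_list H ! i) (vertex_list H ! j))"

lemma vertex_vec_carrier [simp]: "vertex_vec H p \<in> carrier_vec (card (pverts H))"
  by (simp add: vertex_vec_def)

lemma vertex_mat_carrier [simp]: "vertex_mat H q \<in> carrier_mat (card (pverts H)) (card (pverts H))"
  by (simp add: vertex_mat_def)

abbreviation deg :: "'a pair_pre_digraph \<Rightarrow> 'a \<Rightarrow> real" where
  "deg H v \<equiv> real (out_degree (with_proj H) v)"

lemma (in pair_graph) vertex_list_props: "distinct (vertex_list G)" "set (vertex_list G) = pverts G"
  "length (vertex_list G) = card (pverts G)"
proof -
  have "\<exists>vs. distinct vs \<and> set vs = pverts G"
    using finite_distinct_list[OF pair_finite_verts] by blast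
  then have "distinct (vertex_list G) \<and> set (vertex_list G) = pverts G"
    unfolding vertex_list_def by (rule someI_ex)
  then show "distinct (vertex_list G)" "set (vertex_list G) = pverts G"
    "length (vertex_list G) = card (pverts G)"
    using distinct_card by fastforce+
qed

lemma (in pair_graph) vertex_list_in [simp]: "i < card (pverts G) \<Longrightarrow> vertex_list G ! i \<in> pverts G"
  using vertex_list_props nth_mem by metis

lemma (in pair_graph) vertex_list_eq_iff:
  "i < card (pverts G) \<Longrightarrow> j < card (pverts G) \<Longrightarrow> vertex_list G ! i = vertex_list G ! j \<longleftrightarrow> i = j"
  using vertex_list_props nth_eq_iff_index_eq by metis

lemma (in pair_graph) sum_vertex_list:
  fixes F :: "'a \<Rightarrow> real"
  shows "(\<Sum>i<card (pverts G). F (vertex_list G ! i)) = (\<Sum>v\<in>pverts G. F v)"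
  using vertex_list_props by (intro sum.reindex_bij_betw bij_betw_nth) auto

lemma (in pair_graph) vertex_vec_cases:
  assumes "v \<in> carrier_vec (card (pverts G))"
  obtains p where "v = vertex_vec G p"
proof
  show "v = vertex_vec G (\<lambda>a. v $ inv_into {..<card (pverts G)} ((!) (vertex_list G)) a)"
  proof (rule eq_vecI)
    fix i assume "i < dim_vec (vertex_vec G (\<lambda>a. v $ inv_into {..<card (pverts G)} ((!) (vertex_list G)) a))"
    then have i: "i < card (pverts G)" by (simp add: vertex_vec_def)
    have "inj_on ((!) (vertex_list G)) {..<card (pverts G)}"
      by (simp add: inj_on_def vertex_list_eq_iff)
    then show "v $ i = vertex_vec G (\<lambda>a. v $ inv_into {..<card (pverts G)} ((!) (vertex_list G)) a) $ i"
      using i by (simp add: vertex_vec_def inv_into_f_f)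
  qed (use assms in \<open>simp add: vertex_vec_def\<close>)
qed

lemma (in pair_graph) vertex_vec_eq_iff: "vertex_vec G p = vertex_vec G q \<longleftrightarrow> (\<forall>a\<in>pverts G. p a = q a)"
proof
  assume eq: "vertex_vec G p = vertex_vec G q"
  show "\<forall>a\<in>pverts G. p a = q a"
  proof
    fix a assume "a \<in> pverts G"
    then obtain i where "i < card (pverts G)" "a = vertex_list G ! i"
      using vertex_list_props by (metis in_set_conv_nth)
    then show "p a = q a" using arg_cong[OF eq, of "\<lambda>x. x $ i"] by (simp add: vertex_vec_def)
  qed
qed (auto simp: vertex_vec_def)

lemma (in pair_graph) vertex_mat_mult_vec: "vertex_mat G q *\<^sub>v vertex_vec G p = vertex_vec G (\<lambda>a. \<Sum>b\<in>pverts G. q a b * p b)"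
  by (rule eq_vecI)
    (simp_all add: vertex_mat_def vertex_vec_def scalar_prod_def lessThan_atLeast0[symmetric] flip: sum_vertex_list)

lemma (in pair_graph) vertex_mat_mult: "vertex_mat G q * vertex_mat G q' = vertex_mat G (\<lambda>a c. \<Sum>b\<in>pverts G. q a b * q' b c)"
  by (rule eq_matI)
    (simp_all add: vertex_mat_def scalar_prod_def lessThan_atLeast0[symmetric] flip: sum_vertex_list)

lemma (in pair_graph) vertex_vec_scalar_prod: "vertex_vec G p \<bullet> vertex_vec G q = (\<Sum>a\<in>pverts G. p a * q a)"
  by (simp add: vertex_vec_def scalar_prod_def lessThan_atLeast0[symmetric] flip: sum_vertex_list)

lemma (in pair_graph) vertex_mat_cong:
  "(\<And>a b. a \<in> pverts G \<Longrightarrow> b \<in> pverts G \<Longrightarrow> q a b = q' a b) \<Longrightarrow> vertex_mat G q = vertex_mat G q'"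
  by (rule eq_matI) (auto simp: vertex_mat_def)

lemma (in pair_graph) sum_adjacent:
  fixes F :: "'a \<Rightarrow> 'a \<Rightarrow> real"
  shows "(\<Sum>a\<in>pverts G. \<Sum>b\<in>pverts G. if (a, b) \<in> parcs G then F a b else 0) = (\<Sum>(a, b)\<in>parcs G. F a b)"
proof -
  have sub: "parcs G \<subseteq> pverts G \<times> pverts G" using wellformed' by auto
  have "(\<Sum>a\<in>pverts G. \<Sum>b\<in>pverts G. if (a, b) \<in> parcs G then F a b else 0)
      = (\<Sum>e\<in>pverts G \<times> pverts G. if e \<in> parcs G then F (fst e) (snd e) else 0)"
    by (simp add: sum.cartesian_product case_prod_beta)
  also have "\<dots> = (\<Sum>e\<in>parcs G. F (fst e) (snd e))"
    using sub pair_finite_verts by (simp add: sum.inter_restrict[symmetric] Int_absorb1)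
  finally show ?thesis by (simp add: case_prod_beta)
qed

lemma (in pair_graph) sum_neighbours_const:
  fixes c :: real
  assumes "a \<in> pverts G"
  shows "(\<Sum>b\<in>pverts G. if (a, b) \<in> parcs G then c else 0) = deg G a * c"
proof -
  have "out_arcs G a = Pair a ` {b \<in> pverts G. (a, b) \<in> parcs G}"
    using wellformed' by (auto simp: out_arcs_def image_iff)
  then have "out_degree G a = card {b \<in> pverts G. (a, b) \<in> parcs G}"
    by (simp add: out_degree_def card_image inj_on_def)
  then show ?thesis
    using pair_finite_verts by (simp add: sum.If_cases Int_def)
qed

lemma (in pair_graph) sum_deg:
  fixes F :: "'a \<Rightarrow> real"
  shows "(\<Sum>a\<in>pverts G. deg G a * F a) = (\<Sum>(a, b)\<in>parcs G. F a)"
  by (subst sum_adjacent[symmetric]) (intro sum.cong refl, simp only: sum_neighbours_const)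

text \<open>
  Summation by parts: the right-hand side pairs \<open>f\<close> with the combinatorial Laplacian of \<open>h\<close>. It turns the
  weak Poisson equation into the pointwise one and back.
\<close>

lemma (in pair_graph) energy_by_parts:
  fixes f h :: "'a \<Rightarrow> real"
  shows "(\<Sum>(a, b)\<in>parcs G. (f a - f b) * (h a - h b))
    = 2 * (\<Sum>a\<in>pverts G. f a * (\<Sum>b\<in>pverts G. if (a, b) \<in> parcs G then h a - h b else 0))"
proof -
  have "(\<Sum>(a, b)\<in>parcs G. (f a - f b) * (h a - h b))
      = (\<Sum>(a, b)\<in>parcs G. f a * (h a - h b)) + (\<Sum>(a, b)\<in>parcs G. f b * (h b - h a))"
    unfolding sum.distrib[symmetric] by (intro sum.cong refl) (auto simp: algebra_simps)
  also have "(\<Sum>(a, b)\<in>parcs G. f b * (h b - h a)) = (\<Sum>(a, b)\<in>parcs G. f a * (h a - h b))"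
    by (rule sum_parcs_swap)
  also have "(\<Sum>(a, b)\<in>parcs G. f a * (h a - h b))
      = (\<Sum>a\<in>pverts G. f a * (\<Sum>b\<in>pverts G. if (a, b) \<in> parcs G then h a - h b else 0))"
    unfolding sum_adjacent[symmetric] sum_distrib_left by (intro sum.cong refl) auto
  finally show ?thesis by simp
qed

section \<open>The Kirchhoff index in terms of a Green function\<close>

lemma (in pair_graph) green_kernel_pointwise:
  assumes "green_kernel G r g" "a \<in> pverts G" "j \<in> pverts G"
  shows "(\<Sum>b\<in>pverts G. if (a, b) \<in> parcs G then g a j - g b j else 0)
    = (if a = j then 1 else 0) - (if a = r then 1 else 0)"
proof -
  let ?f = "\<lambda>x. if x = a then 1 else 0 :: real"
  have "2 * (?f j - ?f r) = (\<Sum>(x, y)\<in>parcs G. (?f x - ?f y) * (g x j - g y j))"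
    using assms by (simp add: green_kernel_def)
  also have "\<dots> = 2 * (\<Sum>x\<in>pverts G. ?f x * (\<Sum>b\<in>pverts G. if (x, b) \<in> parcs G then g x j - g b j else 0))"
    by (rule energy_by_parts)
  also have "\<dots> = 2 * (\<Sum>b\<in>pverts G. if (a, b) \<in> parcs G then g a j - g b j else 0)"
    using assms(2) pair_finite_verts by (simp add: if_distrib[of "\<lambda>x. x * _"] cong: if_cong)
  finally show ?thesis by auto
qed

text \<open>
  A current can only reach the root through edges: at an isolated vertex the pointwise equation would say
  that this vertex is the root and the only vertex, but then there could be no arc.
\<close>

lemma (in pair_graph) green_kernel_deg_pos:
  assumes "green_kernel G r g" "parcs G \<noteq> {}" "a \<in> pverts G"
  shows "deg G a > 0"
proof (rule ccontr)
  assume "\<not> deg G a > 0"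
  then have "deg G a = 0" by simp
  then have "(\<Sum>b\<in>pverts G. if (a, b) \<in> parcs G then 1 else 0 :: real) = 0"
    using sum_neighbours_const[OF assms(3), of 1] by simp
  then have none: "(a, b) \<notin> parcs G" if "b \<in> pverts G" for b
    using that pair_finite_verts by (subst (asm) sum_nonneg_eq_0_iff) (auto split: if_splits)
  have eq: "a = j \<longleftrightarrow> a = r" if "j \<in> pverts G" for j
    using green_kernel_pointwise[OF assms(1,3) that] none by (auto split: if_splits)
  obtain x y where xy: "(x, y) \<in> parcs G" using assms(2) by auto
  have "x = a" "y = a" using eq[of x] eq[of y] eq[of a] wellformed'[OF xy] assms(3) by auto
  then show False using xy no_loops' by blast
qed

definition (in pair_graph) laplacian_entry :: "'a \<Rightarrow> 'a \<Rightarrow> real" where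
  "laplacian_entry a b = (if a = b then 1 else 0) - (if (a, b) \<in> parcs G then 1 / (sqrt (deg G a) * sqrt (deg G b)) else 0)"

lemma (in pair_graph) normalized_laplacian_vertex_mat: "normalized_laplacian G = vertex_mat G laplacian_entry"
proof (rule eq_matI)
  let ?N = "card (pverts G)" and ?v = "\<lambda>i. vertex_list G ! i"
  fix i j assume "i < dim_row (vertex_mat G laplacian_entry)" "j < dim_col (vertex_mat G laplacian_entry)"
  then have ij: "i < ?N" "j < ?N" by (simp_all add: vertex_mat_def)
  have DA: "(degree_inv_sqrt_mat G * adjacency_mat G) $$ (i, k)
      = (if (?v i, ?v k) \<in> parcs G then 1 / sqrt (deg G (?v i)) else 0)" if "k < ?N" for k
    using ij that by (simp add: degree_inv_sqrt_mat_def adjacency_mat_def scalar_prod_def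
        if_distrib[of "\<lambda>x. x * _"] cong: if_cong)
  have "(degree_inv_sqrt_mat G * adjacency_mat G * degree_inv_sqrt_mat G) $$ (i, j)
      = (\<Sum>k = 0..<?N. (degree_inv_sqrt_mat G * adjacency_mat G) $$ (i, k) * degree_inv_sqrt_mat G $$ (k, j))"
    using ij by (subst index_mult_mat(1)) (auto simp: degree_inv_sqrt_mat_def adjacency_mat_def scalar_prod_def intro!: sum.cong)
  also have "\<dots> = (\<Sum>k = 0..<?N. if k = j then (degree_inv_sqrt_mat G * adjacency_mat G) $$ (i, j) * (1 / sqrt (deg G (?v j))) else 0)"
    using ij by (intro sum.cong) (auto simp: degree_inv_sqrt_mat_def)
  also have "\<dots> = (if (?v i, ?v j) \<in> parcs G then 1 / (sqrt (deg G (?v i)) * sqrt (deg G (?v j))) else 0)"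
    using ij DA[of j] by simp
  finally show "normalized_laplacian G $$ (i, j) = vertex_mat G laplacian_entry $$ (i, j)"
    using ij by (simp add: normalized_laplacian_def vertex_mat_def laplacian_entry_def vertex_list_eq_iff
        degree_inv_sqrt_mat_def del: index_mult_mat(1))
qed (simp_all add: normalized_laplacian_def vertex_mat_def degree_inv_sqrt_mat_def)

text \<open>
  Scaling by the square roots of the degrees turns the normalized Laplacian into the combinatorial one.
\<close>

lemma (in pair_graph) laplacian_sqrt_deg:
  assumes pos: "\<And>v. v \<in> pverts G \<Longrightarrow> deg G v > 0" and a: "a \<in> pverts G"
  shows "(\<Sum>b\<in>pverts G. laplacian_entry a b * (sqrt (deg G b) * x b))
    = (\<Sum>b\<in>pverts G. if (a, b) \<in> parcs G then x a - x b else 0) / sqrt (deg G a)"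
proof -
  have "(\<Sum>b\<in>pverts G. laplacian_entry a b * (sqrt (deg G b) * x b))
      = (\<Sum>b\<in>pverts G. if a = b then sqrt (deg G a) * x a else 0)
        - (\<Sum>b\<in>pverts G. if (a, b) \<in> parcs G then x b / sqrt (deg G a) else 0)"
    unfolding sum_subtractf[symmetric] using pos by (intro sum.cong refl) (auto simp: laplacian_entry_def left_diff_distrib)
  also have "(\<Sum>b\<in>pverts G. if a = b then sqrt (deg G a) * x a else 0) = deg G a * (x a / sqrt (deg G a))"
    using a pos[OF a] pair_finite_verts by (simp add: real_div_sqrt field_simps flip: real_sqrt_mult)
  also have "\<dots> = (\<Sum>b\<in>pverts G. if (a, b) \<in> parcs G then x a / sqrt (deg G a) else 0)"
    by (rule sum_neighbours_const[OF a, symmetric])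
  also have "\<dots> - (\<Sum>b\<in>pverts G. if (a, b) \<in> parcs G then x b / sqrt (deg G a) else 0)
      = (\<Sum>b\<in>pverts G. if (a, b) \<in> parcs G then x a - x b else 0) / sqrt (deg G a)"
    unfolding sum_subtractf[symmetric] sum_divide_distrib by (intro sum.cong refl) (auto simp: diff_divide_distrib)
  finally show ?thesis .
qed

text \<open>
  The kernel of the normalized Laplacian is spanned by \<open>w = (\<surd>d\<^sub>a)\<close>: if \<open>v = (\<surd>d\<^sub>a x\<^sub>a)\<close> lies in it, then \<open>x\<close>
  has zero energy, and the reproducing property makes it constant. At this point the existence of a Green
  function does the work of connectedness.
\<close>

lemma (in pair_graph) degree_kirchhoff_index_eq_kirchhoff_sum:
  assumes green: "green_kernel G r g" and ne: "parcs G \<noteq> {}"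
  shows "degree_kirchhoff_index G = kirchhoff_sum G g"
proof -
  let ?N = "card (pverts G)" and ?V = "pverts G" and ?L = "normalized_laplacian G"
  let ?s = "\<lambda>a. sqrt (deg G a)"
  have pos: "deg G a > 0" if "a \<in> ?V" for a
    using green_kernel_deg_pos[OF green ne that] .
  have ss: "?s a * ?s a = deg G a" for a by simp
  have r: "r \<in> ?V" using green by (simp add: green_kernel_def)
  define m where "m = real (card (parcs G))"
  have m: "m > 0" using ne pair_finite_arcs by (simp add: m_def card_gt_0_iff)
  define w where "w = vertex_vec G ?s"
  define u where "u = vertex_vec G (\<lambda>a. ?s a / m)"
  \<comment> \<open>Subtracting the degree-weighted mean of each row makes \<open>X\<close> annihilate \<open>w\<close>.\<close>
  define \<gamma> where "\<gamma> a = (\<Sum>(c, d)\<in>parcs G. g a c) / m" for a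
  define X where "X = vertex_mat G (\<lambda>a c. ?s a * (g a c - \<gamma> a) * ?s c)"
  have L: "?L = vertex_mat G laplacian_entry" by (rule normalized_laplacian_vertex_mat)
  have L_sqrt: "?L *\<^sub>v vertex_vec G (\<lambda>a. ?s a * x a)
      = vertex_vec G (\<lambda>a. (\<Sum>b\<in>?V. if (a, b) \<in> parcs G then x a - x b else 0) / ?s a)" for x
    unfolding L vertex_mat_mult_vec vertex_vec_eq_iff using laplacian_sqrt_deg[OF pos] by blast
  have repr: "\<exists>x. v = vertex_vec G (\<lambda>a. ?s a * x a)" if v: "v \<in> carrier_vec ?N" for v
  proof -
    obtain p where "v = vertex_vec G p" using vertex_vec_cases[OF v] .
    then have "v = vertex_vec G (\<lambda>a. ?s a * (p a / ?s a))"
      using pos by (force simp: vertex_vec_eq_iff)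
    then show ?thesis by (rule exI[of _ "\<lambda>a. p a / ?s a"])
  qed
  have quad: "vertex_vec G (\<lambda>a. ?s a * x a) \<bullet> (?L *\<^sub>v vertex_vec G (\<lambda>a. ?s a * x a))
      = (\<Sum>(a, b)\<in>parcs G. (x a - x b) * (x a - x b)) / 2" for x
    unfolding L_sqrt vertex_vec_scalar_prod energy_by_parts using pos by (force intro: sum.cong)
  have "(\<Sum>i = 2..?N. 1 / (sorted_list_of_multiset (proots (char_poly ?L)) ! (i - 1))) = (\<Sum>i<?N. X $$ (i, i))"
  proof (rule sum_inverse_nonzero_eigenvalues[where w = w and u = u])
    show "w \<noteq> 0\<^sub>v ?N"
    proof
      assume "w = 0\<^sub>v ?N"
      also have "0\<^sub>v ?N = vertex_vec G (\<lambda>_. 0)" by (auto simp: vertex_vec_def)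
      finally show False using pos[OF r] r by (simp add: w_def vertex_vec_eq_iff)
    qed
    show "?L $$ (i, j) = ?L $$ (j, i)" if "i < ?N" "j < ?N" for i j
      using that arcs_symmetric by (auto simp: L vertex_mat_def laplacian_entry_def mult.commute)
    show "v \<bullet> (?L *\<^sub>v v) \<ge> 0" if v: "v \<in> carrier_vec ?N" for v
    proof -
      obtain x where "v = vertex_vec G (\<lambda>a. ?s a * x a)" using repr[OF v] ..
      then show ?thesis by (simp add: quad sum_nonneg case_prod_beta)
    qed
    have zero: "0\<^sub>v ?N = vertex_vec G (\<lambda>_. 0)" by (auto simp: vertex_vec_def)
    show "?L *\<^sub>v w = 0\<^sub>v ?N"
      using L_sqrt[of "\<lambda>_. 1"] by (simp add: w_def zero cong: if_cong)
    show "\<exists>c. v = c \<cdot>\<^sub>v w" if v: "v \<in> carrier_vec ?N" and Lv: "?L *\<^sub>v v = 0\<^sub>v ?N" for v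
    proof -
      obtain x where x: "v = vertex_vec G (\<lambda>a. ?s a * x a)" using repr[OF v] ..
      have "(\<Sum>(a, b)\<in>parcs G. (x a - x b) * (x a - x b)) = 0"
        using quad[of x] Lv v by (simp add: x[symmetric])
      then have flat: "x a - x b = 0" if "(a, b) \<in> parcs G" for a b
        using that pair_finite_arcs by (subst (asm) sum_nonneg_eq_0_iff) auto
      have "x j = x r" if "j \<in> ?V" for j
      proof -
        have "2 * (x j - x r) = (\<Sum>(a, b)\<in>parcs G. (x a - x b) * (g a j - g b j))"
          using green that by (simp add: green_kernel_def)
        also have "\<dots> = 0" using flat by (intro sum.neutral) auto
        finally show ?thesis by simp
      qed
      then have "v = x r \<cdot>\<^sub>v w"
        unfolding x w_def by (intro eq_vecI) (simp_all add: vertex_vec_def)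
      then show ?thesis ..
    qed
    show "X *\<^sub>v w = 0\<^sub>v ?N"
    proof -
      have "(\<Sum>c\<in>?V. ?s a * (g a c - \<gamma> a) * ?s c * ?s c) = 0" for a
      proof -
        have "(\<Sum>c\<in>?V. ?s a * (g a c - \<gamma> a) * ?s c * ?s c) = (\<Sum>c\<in>?V. deg G c * (?s a * (g a c - \<gamma> a)))"
          using ss by (intro sum.cong refl) (simp add: mult.assoc mult.commute)
        also have "\<dots> = ?s a * ((\<Sum>(c, d)\<in>parcs G. g a c) - m * \<gamma> a)"
          unfolding sum_deg by (simp add: case_prod_beta sum_subtractf m_def flip: sum_distrib_left)
        finally show ?thesis using m by (simp add: \<gamma>_def)
      qed
      then show ?thesis by (simp add: X_def w_def vertex_mat_mult_vec zero)
    qed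
    show "?L * X = 1\<^sub>m ?N - mat ?N ?N (\<lambda>(i, j). w $ i * u $ j)"
    proof -
      have entry: "(\<Sum>b\<in>?V. laplacian_entry a b * (?s b * (g b c - \<gamma> b) * ?s c))
          = (if a = c then 1 else 0) - ?s a * (?s c / m)" if a: "a \<in> ?V" and c: "c \<in> ?V" for a c
      proof -
        let ?\<Delta> = "\<lambda>h. \<Sum>b\<in>?V. if (a, b) \<in> parcs G then h a - h b else 0 :: real"
        have "(\<Sum>b\<in>?V. laplacian_entry a b * (?s b * (g b c - \<gamma> b) * ?s c))
            = (\<Sum>b\<in>?V. laplacian_entry a b * (?s b * (g b c - \<gamma> b))) * ?s c"
          unfolding sum_distrib_right by (simp add: mult.assoc)
        also have "\<dots> = ?\<Delta> (\<lambda>b. g b c - \<gamma> b) / ?s a * ?s c"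
          by (simp only: laplacian_sqrt_deg[OF pos a])
        also have "?\<Delta> (\<lambda>b. g b c - \<gamma> b) = ?\<Delta> (\<lambda>b. g b c) - ?\<Delta> \<gamma>"
          unfolding sum_subtractf[symmetric] by (intro sum.cong refl) auto
        also have "?\<Delta> \<gamma> = (\<Sum>(c, d)\<in>parcs G. ?\<Delta> (\<lambda>b. g b c)) / m"
        proof -
          have "?\<Delta> \<gamma> = (\<Sum>b\<in>?V. \<Sum>(c, d)\<in>parcs G. (if (a, b) \<in> parcs G then g a c - g b c else 0) / m)"
            by (intro sum.cong refl)
              (simp add: \<gamma>_def case_prod_beta sum_subtractf diff_divide_distrib sum_divide_distrib)
          also have "\<dots> = (\<Sum>(c, d)\<in>parcs G. \<Sum>b\<in>?V. (if (a, b) \<in> parcs G then g a c - g b c else 0) / m)"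
            unfolding case_prod_beta by (rule sum.swap)
          finally show ?thesis by (simp add: sum_divide_distrib case_prod_beta)
        qed
        also have "(\<Sum>(c, d)\<in>parcs G. ?\<Delta> (\<lambda>b. g b c))
            = (\<Sum>(c, d)\<in>parcs G. (if a = c then 1 else 0) - (if a = r then 1 else 0))"
        proof (intro sum.cong refl, clarify)
          fix c d assume "(c, d) \<in> parcs G"
          then have "c \<in> ?V" by (rule in_arcsD1)
          then show "?\<Delta> (\<lambda>b. g b c) = (if a = c then 1 else 0) - (if a = r then 1 else 0)"
            by (rule green_kernel_pointwise[OF green a])
        qed
        also have "\<dots> = deg G a - m * (if a = r then 1 else 0)"
        proof -
          have "(\<Sum>(c, d)\<in>parcs G. if a = c then 1 else 0) = (\<Sum>c\<in>?V. deg G c * (if a = c then 1 else 0))"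
            by (rule sum_deg[symmetric])
          also have "\<dots> = (\<Sum>c\<in>?V. if a = c then deg G a else 0)"
            by (intro sum.cong) auto
          also have "\<dots> = deg G a" using a pair_finite_verts by simp
          finally show ?thesis by (simp add: case_prod_beta sum_subtractf m_def)
        qed
        also have "?\<Delta> (\<lambda>b. g b c) = (if a = c then 1 else 0) - (if a = r then 1 else 0)"
          by (rule green_kernel_pointwise[OF green a c])
        also have "((if a = c then 1 else 0) - (if a = r then 1 else 0) - (deg G a - m * (if a = r then 1 else 0)) / m)
            = (if a = c then 1 else 0) - deg G a / m"
          using m by (simp add: diff_divide_distrib)
        also have "\<dots> / ?s a * ?s c = (if a = c then 1 else 0) - ?s a * (?s c / m)"
          using pos[OF a] ss[of a] m by (auto simp: field_simps)
        finally show ?thesis .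
      qed
      have "?L * X = vertex_mat G (\<lambda>a c. (if a = c then 1 else 0) - ?s a * (?s c / m))"
        unfolding L X_def vertex_mat_mult using entry by (intro vertex_mat_cong) auto
      also have "\<dots> = 1\<^sub>m ?N - mat ?N ?N (\<lambda>(i, j). w $ i * u $ j)"
        by (rule eq_matI) (auto simp: vertex_mat_def w_def u_def vertex_vec_def vertex_list_eq_iff)
      finally show ?thesis .
    qed
  qed (simp_all add: w_def u_def X_def L)
  also have "(\<Sum>i<?N. X $$ (i, i)) = (\<Sum>i<?N. deg G (vertex_list G ! i) * (g (vertex_list G ! i) (vertex_list G ! i) - \<gamma> (vertex_list G ! i)))"
    by (intro sum.cong refl) (simp add: X_def vertex_mat_def mult.commute mult.left_commute)
  also have "\<dots> = (\<Sum>(a, b)\<in>parcs G. g a a - \<gamma> a)"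
    unfolding sum_vertex_list[of "\<lambda>a. deg G a * (g a a - \<gamma> a)"] by (rule sum_deg)
  finally have "degree_kirchhoff_index G = m * (\<Sum>(a, b)\<in>parcs G. g a a - \<gamma> a)"
    unfolding degree_kirchhoff_index_def laplacian_eigenvalues_def m_def
    by (simp add: card_edge_set_oriented card_parcs_oriented)
  also have "\<dots> = kirchhoff_sum G g"
    using m by (simp add: kirchhoff_sum_def \<gamma>_def m_def case_prod_beta sum_subtractf right_diff_distrib flip: sum_divide_distrib)
  finally show ?thesis .
qed

section \<open>Connected graphs have a Green function\<close>

lemma (in pair_graph) connected_constant:
  assumes "Digraph_Component.connected (with_proj G)"
    and flat: "\<And>a b. (a, b) \<in> parcs G \<Longrightarrow> p a = p b"
    and "u \<in> pverts G" "v \<in> pverts G"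
  shows "p u = p v"
proof -
  have "u \<rightarrow>\<^sup>*\<^bsub>with_proj (mk_symmetric (with_proj G))\<^esub> v"
    using assms unfolding Digraph_Component.connected_def strongly_connected_def by simp
  then have "u \<rightarrow>\<^sup>*\<^bsub>with_proj G\<^esub> v"
    using reachable_mk_symmetric_eq sym_arcs by blast
  then show ?thesis
  proof (induction rule: reachable_induct)
    case (step x y)
    then show ?case using flat[of x y] by simp
  qed simp
qed

text \<open>
  Adding \<open>1\<close> to the diagonal entry of the combinatorial Laplacian at the root makes it invertible, since a
  function in the kernel has zero energy and vanishes at the root. Solving with the right-hand side
  \<open>\<delta>\<^sub>j - \<delta>\<^sub>r\<close> gives a function that vanishes at the root, because summing all equations leaves only
  its value there; so the added entry has no effect on it.
\<close>

lemma (in pair_graph) connected_green_kernel: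
  assumes conn: "Digraph_Component.connected (with_proj G)" and r: "r \<in> pverts G"
  obtains g where "green_kernel G r g"
proof -
  let ?N = "card (pverts G)" and ?V = "pverts G"
  define k where "k a b = (if a = b then deg G a else 0) - (if (a, b) \<in> parcs G then 1 else 0)
      + (if a = r \<and> b = r then 1 else 0)" for a b
  have k: "(\<Sum>b\<in>?V. k a b * p b) = (\<Sum>b\<in>?V. if (a, b) \<in> parcs G then p a - p b else 0) + (if a = r then p r else 0)"
    if "a \<in> ?V" for a p
  proof -
    have "(\<Sum>b\<in>?V. k a b * p b) = (\<Sum>b\<in>?V. if a = b then deg G a * p a else 0)
        - (\<Sum>b\<in>?V. if (a, b) \<in> parcs G then p b else 0) + (\<Sum>b\<in>?V. if r = b then (if a = r then p r else 0) else 0)"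
      unfolding sum_subtractf[symmetric] sum.distrib[symmetric] k_def
      by (intro sum.cong refl) (auto simp: algebra_simps)
    also have "(\<Sum>b\<in>?V. if a = b then deg G a * p a else 0) = (\<Sum>b\<in>?V. if (a, b) \<in> parcs G then p a else 0)"
      using that pair_finite_verts by (simp add: sum_neighbours_const)
    also have "(\<Sum>b\<in>?V. if (a, b) \<in> parcs G then p a else 0) - (\<Sum>b\<in>?V. if (a, b) \<in> parcs G then p b else 0)
        = (\<Sum>b\<in>?V. if (a, b) \<in> parcs G then p a - p b else 0)"
      unfolding sum_subtractf[symmetric] by (intro sum.cong refl) auto
    finally show ?thesis using r pair_finite_verts by simp
  qed
  let ?K = "vertex_mat G k"
  have zero: "0\<^sub>v ?N = vertex_vec G (\<lambda>_. 0)" by (auto simp: vertex_vec_def)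
  have "det ?K \<noteq> 0"
  proof
    assume "det ?K = 0"
    then obtain v where v: "v \<in> carrier_vec ?N" "v \<noteq> 0\<^sub>v ?N" "?K *\<^sub>v v = 0\<^sub>v ?N"
      using det_0_iff_vec_prod_zero_field[OF vertex_mat_carrier] by blast
    obtain p where p: "v = vertex_vec G p" using vertex_vec_cases[OF v(1)] .
    have Kp: "(\<Sum>b\<in>?V. if (a, b) \<in> parcs G then p a - p b else 0) + (if a = r then p r else 0) = 0" if "a \<in> ?V" for a
      using v(3) that unfolding p vertex_mat_mult_vec zero vertex_vec_eq_iff by (simp add: k)
    have "(\<Sum>(a, b)\<in>parcs G. (p a - p b) * (p a - p b))
        = 2 * (\<Sum>a\<in>?V. p a * (\<Sum>b\<in>?V. if (a, b) \<in> parcs G then p a - p b else 0))"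
      by (rule energy_by_parts)
    also have "(\<Sum>a\<in>?V. p a * (\<Sum>b\<in>?V. if (a, b) \<in> parcs G then p a - p b else 0)) = (\<Sum>a\<in>?V. if a = r then - (p r * p r) else 0)"
    proof (intro sum.cong refl)
      fix a assume "a \<in> ?V"
      from Kp[OF this] have *: "(\<Sum>b\<in>?V. if (a, b) \<in> parcs G then p a - p b else 0) = - (if a = r then p r else 0)"
        by linarith
      show "p a * (\<Sum>b\<in>?V. if (a, b) \<in> parcs G then p a - p b else 0) = (if a = r then - (p r * p r) else 0)"
        unfolding * by simp
    qed
    also have "\<dots> = - (p r * p r)" using r pair_finite_verts by simp
    finally have energy: "(\<Sum>(a, b)\<in>parcs G. (p a - p b) * (p a - p b)) + 2 * (p r * p r) = 0" by simp
    have nn: "(\<Sum>(a, b)\<in>parcs G. (p a - p b) * (p a - p b)) \<ge> 0"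
      by (intro sum_nonneg) auto
    then have "(\<Sum>(a, b)\<in>parcs G. (p a - p b) * (p a - p b)) = 0" and pr: "p r * p r = 0"
      using energy zero_le_square[of "p r"] by linarith+
    then have flat: "p a = p b" if "(a, b) \<in> parcs G" for a b
      using that pair_finite_arcs by (subst (asm) sum_nonneg_eq_0_iff) auto
    have "p a = 0" if "a \<in> ?V" for a
    proof -
      have "p a = p r" by (rule connected_constant[OF conn _ that r]) (rule flat)
      then show ?thesis using pr by simp
    qed
    then have "v = 0\<^sub>v ?N" by (simp add: p zero vertex_vec_eq_iff)
    then show False using v(2) by simp
  qed
  then have "?K \<in> Units (ring_mat TYPE(real) ?N ())"
    by (intro det_non_zero_imp_unit) simp_all
  then obtain M where M: "M \<in> carrier_mat ?N ?N" "?K * M = 1\<^sub>m ?N"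
    unfolding Units_def ring_mat_def by auto
  have "\<exists>h :: 'a \<Rightarrow> real. \<forall>a\<in>?V. (\<Sum>b\<in>?V. if (a, b) \<in> parcs G then h a - h b else 0)
      = (if a = j then 1 else 0) - (if a = r then 1 else 0)" if j: "j \<in> ?V" for j
  proof -
    define e where "e = vertex_vec G (\<lambda>a. (if a = j then 1 else 0) - (if a = r then 1 else 0))"
    have e: "e \<in> carrier_vec ?N" by (simp add: e_def)
    have "M *\<^sub>v e \<in> carrier_vec ?N" using M(1) e by (rule mult_mat_vec_carrier)
    then obtain h where h: "M *\<^sub>v e = vertex_vec G h" by (rule vertex_vec_cases)
    have "?K *\<^sub>v vertex_vec G h = e"
      unfolding h[symmetric] using assoc_mult_mat_vec[OF vertex_mat_carrier[of G k] M(1) e] M(2) e by simp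
    then have Kh: "(\<Sum>b\<in>?V. if (a, b) \<in> parcs G then h a - h b else 0) + (if a = r then h r else 0)
        = (if a = j then 1 else 0) - (if a = r then 1 else 0)" if "a \<in> ?V" for a
      using that unfolding e_def vertex_mat_mult_vec vertex_vec_eq_iff by (simp add: k)
    have "(\<Sum>a\<in>?V. (\<Sum>b\<in>?V. if (a, b) \<in> parcs G then h a - h b else 0) + (if a = r then h r else 0))
        = (\<Sum>a\<in>?V. (if a = j then 1 else 0) - (if a = r then 1 else 0))"
      by (intro sum.cong refl) (rule Kh)
    then have "(\<Sum>a\<in>?V. \<Sum>b\<in>?V. if (a, b) \<in> parcs G then h a - h b else 0) + h r = 0"
      using r j pair_finite_verts by (simp add: sum.distrib sum_subtractf)
    moreover have "(\<Sum>a\<in>?V. \<Sum>b\<in>?V. if (a, b) \<in> parcs G then h a - h b else 0) = 0"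
      using energy_by_parts[of "\<lambda>_. 1" h] by simp
    ultimately have "h r = 0" by simp
    have "\<forall>a\<in>?V. (\<Sum>b\<in>?V. if (a, b) \<in> parcs G then h a - h b else 0)
        = (if a = j then 1 else 0) - (if a = r then 1 else 0)"
    proof
      fix a assume "a \<in> ?V"
      from Kh[OF this] show "(\<Sum>b\<in>?V. if (a, b) \<in> parcs G then h a - h b else 0)
          = (if a = j then 1 else 0) - (if a = r then 1 else 0)"
        unfolding \<open>h r = 0\<close> by (simp only: if_cancel add_0_right)
    qed
    then show ?thesis by (rule exI[of _ h])
  qed
  then have "\<forall>j\<in>?V. \<exists>h :: 'a \<Rightarrow> real. \<forall>a\<in>?V. (\<Sum>b\<in>?V. if (a, b) \<in> parcs G then h a - h b else 0)
      = (if a = j then 1 else 0) - (if a = r then 1 else 0)" ..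
  from bchoice[OF this] obtain h :: "'a \<Rightarrow> 'a \<Rightarrow> real" where h: "\<forall>j\<in>?V. \<forall>a\<in>?V.
      (\<Sum>b\<in>?V. if (a, b) \<in> parcs G then h j a - h j b else 0)
      = (if a = j then 1 else 0) - (if a = r then 1 else 0)" by blast
  have "green_kernel G r (\<lambda>a j. h j a)"
    unfolding green_kernel_def
  proof (intro conjI ballI allI)
    fix j f assume j: "j \<in> ?V"
    have "(\<Sum>(a, b)\<in>parcs G. (f a - f b) * (h j a - h j b))
        = 2 * (\<Sum>a\<in>?V. (if a = j then f j else 0) - (if a = r then f r else 0))"
      unfolding energy_by_parts using j by (intro arg_cong2[where f = "(*)"] sum.cong refl) (simp add: h)
    also have "\<dots> = 2 * (f j - f r)"
      using j r pair_finite_verts by (simp add: sum_subtractf)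
    finally show "(\<Sum>(a, b)\<in>parcs G. (f a - f b) * (h j a - h j b)) = 2 * (f j - f r)" .
  qed (rule r)
  then show thesis by (rule that)
qed

section \<open>The structure of polygon graphs\<close>

lemma path_vertex_0 [simp]: "path_vertex n u v 0 = Old u"
  by (simp add: path_vertex_def)

lemma path_vertex_n [simp]: "n \<noteq> 0 \<Longrightarrow> path_vertex n u v n = Old v"
  by (simp add: path_vertex_def)

text \<open>
  Since \<open>n \<ge> 2\<close>, at least one end of an arc on a new path is an internal vertex, and that vertex carries
  the edge and the position. This underlies the three lemmas on path arcs.
\<close>

lemma path_arc_inj:
  assumes "n \<ge> 2" "k < n" "k' < n" 
    and "path_vertex n u v k = path_vertex n u' v' k'"
    and "path_vertex n u v (Suc k) = path_vertex n u' v' (Suc k')"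
  shows "u = u' \<and> v = v' \<and> k = k'"
  using assms by (auto simp: path_vertex_def split: if_splits)

lemma path_arc_no_reversal:
  assumes "n \<ge> 2" "k < n" "k' < n" "u \<noteq> v"
    and "path_vertex n u v k = path_vertex n u' v' (Suc k')"
  shows "path_vertex n u v (Suc k) \<noteq> path_vertex n u' v' k'"
  using assms by (auto simp: path_vertex_def split: if_splits)

lemma path_arc_not_Old:
  assumes "n \<ge> 2" "k < n"
  shows "path_vertex n u v k \<noteq> Old a \<or> path_vertex n u v (Suc k) \<noteq> Old b"
  using assms by (auto simp: path_vertex_def split: if_splits)

text \<open>
  All sums over a polygon graph are computed with this decomposition into old arcs and paths.
\<close>

lemma sum_parcs_polygon_step:
  fixes F :: "'a pvert \<Rightarrow> 'a pvert \<Rightarrow> real"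
  assumes "pair_graph G" "n \<ge> 2"
  shows "(\<Sum>(x, y)\<in>parcs (polygon_step n G). F x y)
    = (\<Sum>(u, v)\<in>parcs G. F (Old u) (Old v))
    + (\<Sum>(u, v)\<in>oriented_edges G. \<Sum>k<n.
         F (path_vertex n u v k) (path_vertex n u v (Suc k))
       + F (path_vertex n u v (Suc k)) (path_vertex n u v k))"
proof -
  interpret pair_graph G by fact
  let ?I = "oriented_edges G \<times> {..<n}"
  let ?fw = "\<lambda>((u, v), k). (path_vertex n u v k, path_vertex n u v (Suc k))"
  let ?bw = "\<lambda>((u, v), k). (path_vertex n u v (Suc k), path_vertex n u v k)"
  have arcs: "parcs (polygon_step n G) = map_prod Old Old ` parcs G \<union> (?fw ` ?I \<union> ?bw ` ?I)"
    unfolding polygon_step_def by (auto simp: image_iff) (force+)?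
  have "x = y" if "x \<in> ?I" "y \<in> ?I" "fst (?fw x) = fst (?fw y)" "snd (?fw x) = snd (?fw y)" for x y
  proof -
    obtain u v k u' v' k' where "x = ((u, v), k)" "y = ((u', v'), k')"
      by (metis prod.exhaust)
    with that show ?thesis
      using path_arc_inj[OF assms(2), of k k' u v u' v'] by simp
  qed
  then have inj: "inj_on ?fw ?I" "inj_on ?bw ?I"
    by (intro inj_onI; simp only: case_prod_beta prod.sel prod.inject)+
  have ne: "u \<noteq> v" if "(u, v) \<in> oriented_edges G" for u v
    using that oriented_edges_subset[of G] no_loops' by blast
  have disj1: "?fw ` ?I \<inter> ?bw ` ?I = {}"
  proof -
    have "?fw x \<noteq> ?bw y" if "x \<in> ?I" "y \<in> ?I" for x y
    proof -
      obtain u v k u' v' k' where "x = ((u, v), k)" "y = ((u', v'), k')"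
        by (metis prod.exhaust)
      with that show ?thesis
        using path_arc_no_reversal[OF assms(2), of k k' u v u' v'] ne by auto
    qed
    then show ?thesis by blast
  qed
  have disj2: "map_prod Old Old ` parcs G \<inter> (?fw ` ?I \<union> ?bw ` ?I) = {}"
  proof -
    have "?fw x \<noteq> (Old a, Old b) \<and> ?bw x \<noteq> (Old a, Old b)" if "x \<in> ?I" for x a b
    proof -
      obtain u v k where "x = ((u, v), k)"
        by (metis prod.exhaust)
      with that show ?thesis
        using path_arc_not_Old[OF assms(2), of k u v a b] path_arc_not_Old[OF assms(2), of k u v b a] by auto
    qed
    then show ?thesis by (auto simp: map_prod_def) metis+
  qed
  have "(\<Sum>(x, y)\<in>parcs (polygon_step n G). F x y)
      = (\<Sum>(x, y)\<in>map_prod Old Old ` parcs G. F x y)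
      + ((\<Sum>(x, y)\<in>?fw ` ?I. F x y) + (\<Sum>(x, y)\<in>?bw ` ?I. F x y))"
    unfolding arcs using disj1 disj2 pair_finite_arcs
    by (subst sum.union_disjoint; simp?)+
  also have "(\<Sum>(x, y)\<in>map_prod Old Old ` parcs G. F x y) = (\<Sum>(u, v)\<in>parcs G. F (Old u) (Old v))"
    by (subst sum.reindex) (auto simp: inj_on_def intro!: sum.cong)
  also have "(\<Sum>(x, y)\<in>?fw ` ?I. F x y) = (\<Sum>(u, v)\<in>oriented_edges G. \<Sum>k<n.
         F (path_vertex n u v k) (path_vertex n u v (Suc k)))"
    by (subst sum.reindex[OF inj(1)]) (simp add: sum.cartesian_product case_prod_beta)
  also have "(\<Sum>(x, y)\<in>?bw ` ?I. F x y) = (\<Sum>(u, v)\<in>oriented_edges G. \<Sum>k<n.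
         F (path_vertex n u v (Suc k)) (path_vertex n u v k))"
    by (subst sum.reindex[OF inj(2)]) (simp add: sum.cartesian_product case_prod_beta)
  finally show ?thesis
    by (simp add: sum.distrib case_prod_beta)
qed

lemma pair_graph_polygon_step:
  assumes "pair_graph G" "n \<ge> 2"
  shows "pair_graph (polygon_step n G)"
proof -
  interpret pair_graph G by fact
  let ?T = "polygon_step n G"
  have O: "u \<in> pverts G" "v \<in> pverts G" "u \<noteq> v" if "(u, v) \<in> oriented_edges G" for u v
    using that oriented_edges_subset[of G] wellformed' no_loops' by blast+
  have pv: "path_vertex n u v k \<in> pverts ?T" if "(u, v) \<in> oriented_edges G" "k \<le> n" for u v k
    using that O by (auto simp: path_vertex_def polygon_step_def)
  have wf: "x \<in> pverts ?T \<and> y \<in> pverts ?T" if "(x, y) \<in> parcs ?T" for x y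
  proof -
    have "(x, y) \<in> map_prod Old Old ` parcs G \<or> (\<exists>u v k. (u, v) \<in> oriented_edges G \<and> k < n \<and>
        {x, y} = {path_vertex n u v k, path_vertex n u v (Suc k)})"
      using that by (auto simp: polygon_step_def)
    then show ?thesis
    proof
      assume "(x, y) \<in> map_prod Old Old ` parcs G"
      then show ?thesis using wellformed' by (auto simp: polygon_step_def)
    next
      assume "\<exists>u v k. (u, v) \<in> oriented_edges G \<and> k < n \<and>
        {x, y} = {path_vertex n u v k, path_vertex n u v (Suc k)}"
      then show ?thesis using pv by (auto simp: doubleton_eq_iff)
    qed
  qed
  have "pverts ?T = Old ` pverts G \<union> (\<lambda>((u, v), k). New u v k) ` (oriented_edges G \<times> {0<..<n})"
    by (auto simp: polygon_step_def image_iff) force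
  then have finV: "finite (pverts ?T)"
    using pair_finite_verts by simp
  have "parcs ?T \<subseteq> pverts ?T \<times> pverts ?T"
    using wf by auto
  then have finA: "finite (parcs ?T)"
    using finV finite_subset by blast
  have sym: "(y, x) \<in> parcs ?T" if "(x, y) \<in> parcs ?T" for x y
    using that arcs_symmetric by (auto simp: polygon_step_def) 
  have loop: "x \<noteq> y" if "(x, y) \<in> parcs ?T" for x y
    using that no_loops' O assms(2) by (auto simp: polygon_step_def path_vertex_def split: if_splits)
  show ?thesis
    by unfold_locales (use wf finV finA sym loop in \<open>auto simp: symmetric_def intro!: symI\<close>)
qed

lemma card_pverts_polygon_step:
  assumes "pair_graph G" "n \<ge> 2"
  shows "card (pverts (polygon_step n G)) = card (pverts G) + (n - 1) * card (oriented_edges G)"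
proof -
  interpret pair_graph G by fact
  let ?N = "(\<lambda>((u, v), k). New u v k) ` (oriented_edges G \<times> {0<..<n})"
  have V: "pverts (polygon_step n G) = Old ` pverts G \<union> ?N"
    by (auto simp: polygon_step_def image_iff) force
  moreover have "card (Old ` pverts G \<union> ?N) = card (Old ` pverts G) + card ?N"
    using pair_finite_verts by (intro card_Un_disjoint) auto
  moreover have "card ?N = (n - 1) * card (oriented_edges G)"
    by (subst card_image) (auto simp: inj_on_def card_cartesian_product)
  moreover have "card (Old ` pverts G) = card (pverts G)"
    by (rule card_image) (simp add: inj_on_def)
  ultimately show ?thesis
    by simp
qed

section \<open>The Green function of a polygon graph\<close>

fun interpolate :: "nat \<Rightarrow> ('a pvert \<Rightarrow> real) \<Rightarrow> 'a pvert \<Rightarrow> real" where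
  "interpolate n h (Old u) = h u"
| "interpolate n h (New u v k) = (1 - real k / real n) * h u + real k / real n * h v"
| "interpolate n h (Base a) = 0"

text \<open>
  The Green function of the path \<open>0, \<dots>, n\<close> with both ends grounded.
\<close>

definition segment_green :: "nat \<Rightarrow> nat \<Rightarrow> nat \<Rightarrow> real" where
  "segment_green n k l = real (min k l) * (real n - real (max k l)) / real n"

fun path_green :: "nat \<Rightarrow> 'a pvert \<Rightarrow> 'a pvert \<Rightarrow> real" where
  "path_green n (New u v k) (New u' v' l) = (if u = u' \<and> v = v' then segment_green n k l else 0)"
| "path_green n _ _ = 0"

text \<open>
  The factor is the resistance of an edge of conductance \<open>1\<close> in parallel with a path of conductance \<open>1/n\<close>.
\<close>

definition polygon_green :: "nat \<Rightarrow> ('a pvert \<Rightarrow> 'a pvert \<Rightarrow> real) \<Rightarrow> 'a pvert \<Rightarrow> 'a pvert \<Rightarrow> real" where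
  "polygon_green n g x y =
     real n / (real n + 1) * interpolate n (\<lambda>a. interpolate n (g a) y) x + path_green n x y"

lemma interpolate_path_vertex:
  assumes "n \<ge> 2" "k \<le> n"
  shows "interpolate n h (path_vertex n u v k) = (1 - real k / real n) * h u + real k / real n * h v"
  using assms by (auto simp: path_vertex_def)

lemma path_green_path_vertex:
  assumes "k \<le> n" "l \<le> n"
  shows "path_green n (path_vertex n u v k) (New u' v' l) 
    = (if u = u' \<and> v = v' then segment_green n k l else 0)"
  using assms by (auto simp: path_vertex_def segment_green_def)

lemma path_green_same_path:
  assumes "k \<le> n" "l \<le> n"
  shows "path_green n (path_vertex n u v k) (path_vertex n u v l) = segment_green n k l"
  using assms by (auto simp: path_vertex_def segment_green_def)

lemma path_green_Old [simp]: "path_green n x (Old j) = 0" "path_green n (Old j) x = 0"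
  by (cases x; simp)+

text \<open>
  As a function of its first argument, the Green function of the segment has slope \<open>1 - l/n\<close> before \<open>l\<close> and
  slope \<open>- l/n\<close> after it. So the sum telescopes on either side of \<open>l\<close>, and what is left is the
  deviation of \<open>\<phi>\<close> at \<open>l\<close> from the linear interpolation of its end values.
\<close>

lemma segment_green_reproducing:
  fixes \<phi> :: "nat \<Rightarrow> real"
  assumes "0 < l" "l < n"
  shows "(\<Sum>k<n. (\<phi> (Suc k) - \<phi> k) * (segment_green n (Suc k) l - segment_green n k l))
    = \<phi> l - ((1 - real l / real n) * \<phi> 0 + real l / real n * \<phi> n)"
proof -
  have step: "segment_green n (Suc k) l - segment_green n k l
      = (if k < l then 1 - real l / real n else - (real l / real n))" if "k < n" for k
    using assms that by (auto simp: segment_green_def field_simps max_def min_def)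
  have "(\<Sum>k<n. (\<phi> (Suc k) - \<phi> k) * (segment_green n (Suc k) l - segment_green n k l))
      = (\<Sum>k<n. (\<phi> (Suc k) - \<phi> k) * (if k < l then 1 - real l / real n else - (real l / real n)))"
    by (intro sum.cong) (auto simp: step)
  also have "\<dots> = (\<Sum>k<l. (\<phi> (Suc k) - \<phi> k) * (1 - real l / real n))
      + (\<Sum>k=l..<n. (\<phi> (Suc k) - \<phi> k) * - (real l / real n))"
  proof -
    have "{..<n} = {..<l} \<union> {l..<n}" using assms by auto
    then show ?thesis by (simp add: sum.union_disjoint ivl_disj_int)
  qed
  also have "\<dots> = (\<phi> l - \<phi> 0) * (1 - real l / real n) + (\<phi> n - \<phi> l) * - (real l / real n)"
    using assms by (simp only: sum_distrib_right[symmetric] sum_lessThan_telescope sum_Suc_diff' less_imp_le)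
  also have "\<dots> = \<phi> l - ((1 - real l / real n) * \<phi> 0 + real l / real n * \<phi> n)"
    by (simp add: algebra_simps diff_divide_distrib)
  finally show ?thesis .
qed

lemma green_kernel_interpolate:
  assumes "pair_graph G" "n \<ge> 2" "green_kernel G r g" "y \<in> pverts (polygon_step n G)"
  shows "(\<Sum>(a, b)\<in>parcs G. (f a - f b) * (interpolate n (g a) y - interpolate n (g b) y))
    = 2 * (interpolate n f y - f r)"
proof -
  interpret pair_graph G by fact
  have green: "(\<Sum>(a, b)\<in>parcs G. (f a - f b) * (g a j - g b j)) = 2 * (f j - f r)"
    if "j \<in> pverts G" for j
    using assms(3) that by (simp add: green_kernel_def)
  from assms(4) consider j where "y = Old j" "j \<in> pverts G"
    | u v k where "y = New u v k" "(u, v) \<in> oriented_edges G"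
    by (auto simp: polygon_step_def)
  then show ?thesis
  proof cases
    case 1
    then show ?thesis using green by simp
  next
    case 2
    then have uv: "u \<in> pverts G" "v \<in> pverts G"
      using oriented_edges_subset[of G] wellformed' by blast+
    define t where "t = real k / real n"
    have "(\<Sum>(a, b)\<in>parcs G. (f a - f b) * (interpolate n (g a) y - interpolate n (g b) y))
        = (1 - t) * (\<Sum>(a, b)\<in>parcs G. (f a - f b) * (g a u - g b u))
        + t * (\<Sum>(a, b)\<in>parcs G. (f a - f b) * (g a v - g b v))"
      unfolding sum_distrib_left sum.distrib[symmetric]
      by (intro sum.cong) (auto simp: 2(1) t_def[symmetric] algebra_simps)
    then show ?thesis
      unfolding green[OF uv(1)] green[OF uv(2)] by (simp add: 2(1) t_def[symmetric] algebra_simps)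
  qed
qed

text \<open>
  The energy of a test function \<open>f\<close> against the interpolated potential sees only the old values of \<open>f\<close>,
  once over the old edges and once with weight \<open>1/n\<close> over the paths. The scaling factor makes the two
  parts together reproduce the interpolation of \<open>f\<close> at the source. The segment part supplies exactly the
  difference between \<open>f\<close> and this interpolation.
\<close>

lemma green_kernel_polygon_step:
  assumes "pair_graph G" "n \<ge> 2" "green_kernel G r g"
  shows "green_kernel (polygon_step n G) (Old r) (polygon_green n g)"
  unfolding green_kernel_def
proof (intro conjI ballI allI)
  interpret pair_graph G by fact
  let ?T = "polygon_step n G"
  show "Old r \<in> pverts ?T"
    using assms(3) by (simp add: green_kernel_def polygon_step_def)
  fix y f assume y: "y \<in> pverts ?T"
  define h where "h a = interpolate n (g a) y" for a
  define c where "c = real n / (real n + 1)"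
  define p :: "'a pvert \<Rightarrow> 'a pvert \<Rightarrow> nat \<Rightarrow> 'a pvert" where "p = path_vertex n"
  have pg: "polygon_green n g x y = c * interpolate n h x + path_green n x y" for x
    by (simp add: polygon_green_def h_def[abs_def] c_def)
  define D where "D u v = (\<Sum>k<n. (f (p u v (Suc k)) - f (p u v k))
      * (path_green n (p u v (Suc k)) y - path_green n (p u v k) y))" for u v
  have edge: "(\<Sum>k<n. (f (p u v (Suc k)) - f (p u v k))
        * (polygon_green n g (p u v (Suc k)) y - polygon_green n g (p u v k) y))
      = c / real n * ((f (Old u) - f (Old v)) * (h u - h v)) + D u v" for u v
  proof -
    have "(\<Sum>k<n. (f (p u v (Suc k)) - f (p u v k))
        * (polygon_green n g (p u v (Suc k)) y - polygon_green n g (p u v k) y))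
      = (\<Sum>k<n. (f (p u v (Suc k)) - f (p u v k)) * (c / real n * (h v - h u))) + D u v"
      unfolding D_def sum.distrib[symmetric] using assms(2)
      by (intro sum.cong) (auto simp: pg p_def interpolate_path_vertex field_simps)
    also have "(\<Sum>k<n. (f (p u v (Suc k)) - f (p u v k)) * (c / real n * (h v - h u)))
      = c / real n * ((f (Old u) - f (Old v)) * (h u - h v))"
      using assms(2) unfolding sum_distrib_right[symmetric]
        sum_lessThan_telescope[of "\<lambda>k. f (p u v k)"]
      by (simp add: p_def algebra_simps diff_divide_distrib)
    finally show ?thesis .
  qed
  have D: "(\<Sum>(u, v)\<in>oriented_edges G. D u v) = f y - interpolate n (\<lambda>a. f (Old a)) y"
  proof -
    from y consider j where "y = Old j"
      | u v l where "y = New u v l" "(u, v) \<in> oriented_edges G" "0 < l" "l < n"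
      by (auto simp: polygon_step_def)
    then show ?thesis
    proof cases
      case 1
      then show ?thesis by (simp add: D_def)
    next
      case (2 u v l)
      have pvl: "p u v l = y" using 2 by (simp add: p_def path_vertex_def)
      have "D u v = f y - interpolate n (\<lambda>a. f (Old a)) y"
        using segment_green_reproducing[OF 2(3,4), of "\<lambda>k. f (p u v k)"] 2 assms(2)
        by (simp add: D_def p_def path_green_path_vertex pvl[unfolded p_def])
      moreover have "D u' v' = 0" if "(u', v') \<noteq> (u, v)" for u' v'
        unfolding D_def using that 2 by (intro sum.neutral) (auto simp: p_def path_green_path_vertex)
      then have "(\<Sum>(u', v')\<in>oriented_edges G. D u' v') = (\<Sum>(u', v')\<in>{(u, v)}. D u' v')"
        using 2 by (intro sum.mono_neutral_right) auto
      ultimately show ?thesis by simp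
    qed
  qed
  have S: "2 * (\<Sum>(u, v)\<in>oriented_edges G. (f (Old u) - f (Old v)) * (h u - h v))
      = (\<Sum>(a, b)\<in>parcs G. (f (Old a) - f (Old b)) * (h a - h b))"
    unfolding sum_parcs_oriented sum_distrib_left by (intro sum.cong) (auto simp: algebra_simps)
  have "(\<Sum>(x, z)\<in>parcs ?T. (f x - f z) * (polygon_green n g x y - polygon_green n g z y))
    = c * (\<Sum>(a, b)\<in>parcs G. (f (Old a) - f (Old b)) * (h a - h b))
    + (\<Sum>(u, v)\<in>oriented_edges G. 2 * (\<Sum>k<n. (f (p u v (Suc k)) - f (p u v k))
        * (polygon_green n g (p u v (Suc k)) y - polygon_green n g (p u v k) y)))"
    unfolding sum_parcs_polygon_step[OF assms(1,2)] p_def[symmetric] sum_distrib_left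
    by (intro arg_cong2[where f = "(+)"] sum.cong) (auto simp: pg algebra_simps)
  also have "\<dots> = c * (\<Sum>(a, b)\<in>parcs G. (f (Old a) - f (Old b)) * (h a - h b))
    + c / real n * (\<Sum>(a, b)\<in>parcs G. (f (Old a) - f (Old b)) * (h a - h b))
    + 2 * (\<Sum>(u, v)\<in>oriented_edges G. D u v)"
  proof -
    have "(\<Sum>(u, v)\<in>oriented_edges G. 2 * (c / real n * P u v + D u v))
        = c / real n * (2 * (\<Sum>(u, v)\<in>oriented_edges G. P u v)) + 2 * (\<Sum>(u, v)\<in>oriented_edges G. D u v)" for P
      by (simp add: case_prod_beta sum.distrib sum_distrib_left algebra_simps)
    then show ?thesis unfolding edge S[symmetric] by simp
  qed
  also have "\<dots> = (c + c / real n) * (2 * (interpolate n (\<lambda>a. f (Old a)) y - f (Old r)))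
      + 2 * (f y - interpolate n (\<lambda>a. f (Old a)) y)"
    unfolding D h_def green_kernel_interpolate[OF assms y] by (simp add: algebra_simps)
  also have "c + c / real n = c * ((real n + 1) / real n)"
    using assms(2) by (simp add: field_simps)
  also have "\<dots> = 1"
    using assms(2) by (simp add: c_def)
  finally show "(\<Sum>(x, z)\<in>parcs ?T. (f x - f z) * (polygon_green n g x y - polygon_green n g z y))
      = 2 * (f y - f (Old r))"
    by simp
qed

section \<open>The Kirchhoff sum of a polygon graph\<close>

text \<open>
  The vertices of a path are met as tails and as heads of its arcs, so a sum over the arcs has this shape:
  the inner vertices count twice (their degree is \<open>2\<close>) and the ends once. All the functions to be
  summed along a path are quadratic in the relative position.
\<close>

lemma trapezoid_sum_quadratic:
  fixes F :: "nat \<Rightarrow> real"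
  assumes "n \<noteq> 0"
    and F: "\<And>k. k \<le> n \<Longrightarrow> F k = a + b * (real k / real n) + c * (real k / real n) ^ 2"
  shows "(\<Sum>k<n. F k + F (Suc k)) = 2 * real n * a + real n * b + (2 * real n ^ 2 + 1) / (3 * real n) * c"
proof -
  define q where "q k = a + b * (real k * (1 / real n)) + c * (real k * (1 / real n)) ^ 2" for k
  have partial: "(\<Sum>k<m. q k + q (Suc k))
      = 2 * real m * a + real m ^ 2 * (b / real n) + real m * (2 * real m ^ 2 + 1) / 3 * (c / real n ^ 2)" for m
    using assms(1) by (induction m) (simp_all add: q_def power2_eq_square field_simps)
  have "(\<Sum>k<n. F k + F (Suc k)) = (\<Sum>k<n. q k + q (Suc k))"
    by (intro sum.cong) (auto simp: F q_def)
  also have "\<dots> = 2 * real n * a + real n * b + (2 * real n ^ 2 + 1) / (3 * real n) * c"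
    unfolding partial using assms(1) by (simp add: power2_eq_square)
  finally show ?thesis .
qed

text \<open>
  For fixed \<open>k\<close> the function is linear on either side of \<open>k\<close> and the trapezoidal rule is exact there. The two partial
  sums are proved by induction separately.
\<close>

lemma trapezoid_sum_segment_green:
  assumes "n \<noteq> 0" "k \<le> n"
  shows "(\<Sum>l<n. segment_green n k l + segment_green n k (Suc l)) = real k * (real n - real k)"
proof -
  have left: "(\<Sum>l<m. segment_green n k l + segment_green n k (Suc l)) = real m ^ 2 * (real n - real k) / real n"
    if "m \<le> k" for m
    using that by (induction m) (simp_all add: segment_green_def power2_eq_square algebra_simps add_divide_distrib diff_divide_distrib)
  have right: "(\<Sum>l<m. segment_green n k l + segment_green n k (Suc l))
      = real k ^ 2 * (real n - real k) / real n + real k * ((real n - real k) ^ 2 - (real n - real m) ^ 2) / real n"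
    if "k \<le> m" for m
    using that
  proof (induction m rule: dec_induct)
    case base
    then show ?case using left[of k] by simp
  next
    case (step m)
    then have "segment_green n k m + segment_green n k (Suc m)
        = real k * ((real n - real m) ^ 2 - (real n - real (Suc m)) ^ 2) / real n"
      by (simp add: segment_green_def power2_eq_square add_divide_distrib[symmetric] algebra_simps)
    then show ?case
      using step.IH by (simp add: add_divide_distrib[symmetric] del: of_nat_Suc) (simp add: algebra_simps)
  qed
  show ?thesis
    unfolding right[OF assms(2)] using assms(1) by (simp add: field_simps power2_eq_square)
qed

lemma sum_parcs_polygon_step_tail:
  fixes F :: "'a pvert \<Rightarrow> real"
  assumes "pair_graph G" "n \<ge> 2"
  shows "(\<Sum>(x, y)\<in>parcs (polygon_step n G). F x)
    = (\<Sum>(u, v)\<in>parcs G. F (Old u))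
    + (\<Sum>(u, v)\<in>oriented_edges G. \<Sum>k<n. F (path_vertex n u v k) + F (path_vertex n u v (Suc k)))"
  using sum_parcs_polygon_step[OF assms, of "\<lambda>x y. F x"] by simp

text \<open>
  The path of an edge \<open>uv\<close> passes its weight on to the ends, \<open>n\<close> to each. An old vertex of degree \<open>d\<close> thus
  receives \<open>n d\<close> from the paths in addition to \<open>d\<close> from the old arcs.
\<close>

lemma sum_parcs_interpolate:
  assumes "pair_graph G" "n \<ge> 2"
  shows "(\<Sum>(x, y)\<in>parcs (polygon_step n G). interpolate n h x) = (real n + 1) * (\<Sum>(a, b)\<in>parcs G. h a)"
proof -
  interpret pair_graph G by fact
  have n: "n \<noteq> 0" using assms(2) by simp
  have edge: "(\<Sum>k<n. interpolate n h (path_vertex n u v k) + interpolate n h (path_vertex n u v (Suc k)))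
     = real n * (h u + h v)" for u v
  proof -
    have "interpolate n h (path_vertex n u v k) = h u + (h v - h u) * (real k / real n) + 0 * (real k / real n) ^ 2"
      if "k \<le> n" for k
      using that assms(2) by (simp add: interpolate_path_vertex algebra_simps diff_divide_distrib)
    from trapezoid_sum_quadratic[OF n this] show ?thesis by (simp add: algebra_simps)
  qed
  have "(\<Sum>(u, v)\<in>oriented_edges G. real n * (h u + h v)) = real n * (\<Sum>(a, b)\<in>parcs G. h a)"
    unfolding sum_parcs_oriented[of "\<lambda>a b. h a"] sum_distrib_left by (intro sum.cong) auto
  then show ?thesis
    by (simp add: sum_parcs_polygon_step_tail[OF assms] edge distrib_right)
qed

lemma card_parcs_polygon_step:
  assumes "pair_graph G" "n \<ge> 2"
  shows "card (parcs (polygon_step n G)) = (n + 1) * card (parcs G)"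
proof -
  interpret pair_graph G by fact
  have "real (card (parcs (polygon_step n G))) = (\<Sum>(x, y)\<in>parcs (polygon_step n G). 1)" by simp
  also have "\<dots> = real (card (parcs G)) + real (card (oriented_edges G) * (2 * n))"
    by (subst sum_parcs_polygon_step_tail[OF assms]) simp
  also have "\<dots> = real ((n + 1) * card (parcs G))"
    by (simp add: card_parcs_oriented algebra_simps)
  finally show ?thesis by (simp only: of_nat_eq_iff)
qed

text \<open>
  On the diagonal, the interpolated part is a quadratic polynomial along each path with coefficients \<open>g u u\<close>,
  \<open>g v v\<close> and \<open>g u v + g v u\<close>. The mixed terms add up to the sum over adjacent pairs that Foster's theorem
  expresses by the diagonal sum and the number of vertices.
\<close>

lemma sum_parcs_polygon_green_diag:
  assumes "pair_graph G" "n \<ge> 2" "green_kernel G r g"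
  shows "(\<Sum>(x, y)\<in>parcs (polygon_step n G). polygon_green n g x x)
    = real n * (\<Sum>(a, b)\<in>parcs G. g a a) - (real n - 1) / 3 * (real (card (pverts G)) - 1)
      + (real n ^ 2 - 1) / 3 * real (card (oriented_edges G))"
proof -
  interpret pair_graph G by fact
  define c where "c = real n / (real n + 1)"
  define \<alpha> where "\<alpha> = (2 * real n ^ 2 + 1) / (3 * real n)"
  define \<beta> where "\<beta> = (real n ^ 2 - 1) / (3 * real n)"
  define E where "E = real (card (oriented_edges G))"
  define S where "S = (\<Sum>(a, b)\<in>parcs G. g a a)"
  define T where "T = (\<Sum>(a, b)\<in>parcs G. g a b)"
  define N where "N = real (card (pverts G))"
  have n: "real n > 0" "n \<noteq> 0" using assms(2) by simp_all
  have \<beta>: "\<beta> = real n - \<alpha>"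
    using n by (simp add: \<alpha>_def \<beta>_def field_simps power2_eq_square)
  have edge: "(\<Sum>k<n. polygon_green n g (path_vertex n u v k) (path_vertex n u v k)
        + polygon_green n g (path_vertex n u v (Suc k)) (path_vertex n u v (Suc k)))
     = c * \<alpha> * (g u u + g v v) + c * \<beta> * (g u v + g v u) + real n * \<beta>" for u v
  proof -
    have "polygon_green n g (path_vertex n u v k) (path_vertex n u v k)
      = c * g u u + (c * (g u v + g v u - 2 * g u u) + real n) * (real k / real n)
        + (c * (g u u + g v v - g u v - g v u) - real n) * (real k / real n) ^ 2"
      if "k \<le> n" for k
    proof -
      define t where "t = real k / real n"
      have "real k = t * real n" using n by (simp add: t_def)
      then have "segment_green n k k = real n * t - real n * t ^ 2"
        using n by (simp add: segment_green_def power2_eq_square field_simps)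
      then show ?thesis
        using that assms(2)
        by (simp add: polygon_green_def interpolate_path_vertex path_green_same_path flip: t_def c_def)
          (simp add: power2_eq_square algebra_simps)
    qed
    from trapezoid_sum_quadratic[OF n(2) this] show ?thesis
      by (simp only: \<alpha>_def[symmetric] \<beta>) (simp add: algebra_simps)
  qed
  have lin: "(\<Sum>(u, v)\<in>oriented_edges G. A * P u v + B * Q u v + D)
      = A * (\<Sum>(u, v)\<in>oriented_edges G. P u v) + B * (\<Sum>(u, v)\<in>oriented_edges G. Q u v) + E * D"
    for A B D :: real and P Q
    by (simp add: sum.distrib sum_distrib_left case_prod_beta E_def)
  have "(\<Sum>(x, y)\<in>parcs (polygon_step n G). polygon_green n g x x)
     = c * S + (\<Sum>(u, v)\<in>oriented_edges G. c * \<alpha> * (g u u + g v v) + c * \<beta> * (g u v + g v u) + real n * \<beta>)"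
    unfolding sum_parcs_polygon_step_tail[OF assms(1,2)] edge S_def sum_distrib_left
    by (intro arg_cong2[where f = "(+)"] sum.cong) (auto simp: polygon_green_def c_def)
  also have "\<dots> = c * S + (c * \<alpha> * S + c * \<beta> * T + E * (real n * \<beta>))"
    unfolding lin S_def T_def sum_parcs_oriented ..
  also have "T = S - N + 1"
    unfolding T_def S_def N_def by (rule foster_sum[OF assms(3)])
  also have "c * S + (c * \<alpha> * S + c * \<beta> * (S - N + 1) + E * (real n * \<beta>))
     = (c * (1 + \<alpha> + \<beta>)) * S - c * \<beta> * (N - 1) + real n * \<beta> * E"
    by (simp add: algebra_simps)
  also have "c * \<beta> = (real n - 1) / 3"
    using n by (simp add: c_def \<beta>_def divide_simps) (simp add: power2_eq_square algebra_simps)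
  also have "c * (1 + \<alpha> + \<beta>) = real n"
    using n by (simp add: c_def \<beta> divide_simps)
  also have "real n * \<beta> = (real n ^ 2 - 1) / 3"
    using n by (simp add: \<beta>_def)
  finally show ?thesis by (simp add: S_def N_def E_def)
qed

text \<open>
  Interpolation is undone in each argument separately, which gives the square of \<open>n + 1\<close> and cancels the
  denominator of the resistance factor. The segment part, summed over its second argument, is \<open>k (n - k)\<close> at
  position \<open>k\<close>, again a quadratic polynomial.
\<close>

lemma sum_parcs_polygon_green:
  assumes "pair_graph G" "n \<ge> 2"
  shows "(\<Sum>(x, x')\<in>parcs (polygon_step n G). \<Sum>(y, y')\<in>parcs (polygon_step n G). polygon_green n g x y)
    = real n * (real n + 1) * (\<Sum>(a, b)\<in>parcs G. \<Sum>(c, d)\<in>parcs G. g a c)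
      + real n * (real n ^ 2 - 1) / 3 * real (card (oriented_edges G))"
proof -
  interpret pair_graph G by fact
  let ?A = "parcs (polygon_step n G)"
  have n: "real n > 0" "n \<noteq> 0" using assms(2) by simp_all
  define c where "c = real n / (real n + 1)"
  define \<Phi> where "\<Phi> x = (\<Sum>(y, y')\<in>?A. path_green n x y)" for x
  have \<Phi>_Old: "\<Phi> (Old u) = 0" for u
    by (simp add: \<Phi>_def)
  have \<Phi>_path: "\<Phi> (path_vertex n u v k) = real k * (real n - real k)"
    if uv: "(u, v) \<in> oriented_edges G" and k: "k \<le> n" for u v k
  proof -
    have "\<Phi> (path_vertex n u v k)
      = (\<Sum>(u', v')\<in>oriented_edges G. \<Sum>l<n. path_green n (path_vertex n u v k) (path_vertex n u' v' l) +
           path_green n (path_vertex n u v k) (path_vertex n u' v' (Suc l)))"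
      by (simp add: \<Phi>_def sum_parcs_polygon_step_tail[OF assms])
    also have "\<dots> = (\<Sum>e\<in>oriented_edges G. if e = (u, v) then real k * (real n - real k) else 0)"
    proof (intro sum.cong refl, clarify)
      fix u' v'
      show "(\<Sum>l<n. path_green n (path_vertex n u v k) (path_vertex n u' v' l) +
           path_green n (path_vertex n u v k) (path_vertex n u' v' (Suc l)))
        = (if (u', v') = (u, v) then real k * (real n - real k) else 0)"
      proof (cases "(u', v') = (u, v)")
        case True
        then show ?thesis
          using k trapezoid_sum_segment_green[OF n(2) k] by (simp add: path_green_same_path)
      next
        case False
        then have "path_green n (path_vertex n u v k) (path_vertex n u' v' l) = 0" for l
          by (auto simp: path_vertex_def)
        then show ?thesis using False by auto
      qed
    qed
    also have "\<dots> = real k * (real n - real k)"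
      using uv by simp
    finally show ?thesis .
  qed
  have edge: "(\<Sum>k<n. \<Phi> (path_vertex n u v k) + \<Phi> (path_vertex n u v (Suc k))) = real n * (real n ^ 2 - 1) / 3"
    if "(u, v) \<in> oriented_edges G" for u v
  proof -
    have "\<Phi> (path_vertex n u v k) = 0 + real n ^ 2 * (real k / real n) + - (real n ^ 2) * (real k / real n) ^ 2"
      if "k \<le> n" for k
      using \<Phi>_path[OF \<open>(u, v) \<in> oriented_edges G\<close> that] n by (simp add: power2_eq_square algebra_simps)
    from trapezoid_sum_quadratic[OF n(2) this]
    have "(\<Sum>k<n. \<Phi> (path_vertex n u v k) + \<Phi> (path_vertex n u v (Suc k)))
      = real n * real n ^ 2 - (2 * real n ^ 2 + 1) / (3 * real n) * real n ^ 2"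
      by simp
    also have "\<dots> = real n * (real n ^ 2 - 1) / 3"
      using n by (simp add: field_simps power2_eq_square)
    finally show ?thesis .
  qed
  have "(\<Sum>(x, x')\<in>?A. \<Phi> x) = (\<Sum>(u, v)\<in>oriented_edges G. real n * (real n ^ 2 - 1) / 3)"
  proof -
    have "(\<Sum>(u, v)\<in>oriented_edges G. \<Sum>k<n. \<Phi> (path_vertex n u v k) + \<Phi> (path_vertex n u v (Suc k)))
        = (\<Sum>(u, v)\<in>oriented_edges G. real n * (real n ^ 2 - 1) / 3)"
      by (intro sum.cong refl, clarify) (rule edge)
    then show ?thesis
      by (simp add: sum_parcs_polygon_step_tail[OF assms] \<Phi>_Old)
  qed
  then have bump: "(\<Sum>(x, x')\<in>?A. \<Sum>(y, y')\<in>?A. path_green n x y)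
      = real n * (real n ^ 2 - 1) / 3 * real (card (oriented_edges G))"
    unfolding \<Phi>_def by simp
  have "(\<Sum>(x, x')\<in>?A. \<Sum>(y, y')\<in>?A. polygon_green n g x y)
    = c * (\<Sum>(x, x')\<in>?A. \<Sum>(y, y')\<in>?A. interpolate n (\<lambda>a. interpolate n (g a) y) x)
      + (\<Sum>(x, x')\<in>?A. \<Sum>(y, y')\<in>?A. path_green n x y)"
    by (simp add: polygon_green_def c_def sum.distrib sum_distrib_left case_prod_beta)
  also have "(\<Sum>(x, x')\<in>?A. \<Sum>(y, y')\<in>?A. interpolate n (\<lambda>a. interpolate n (g a) y) x)
     = (\<Sum>(y, y')\<in>?A. \<Sum>(x, x')\<in>?A. interpolate n (\<lambda>a. interpolate n (g a) y) x)"
    unfolding case_prod_beta by (rule sum.swap)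
  also have "\<dots> = (real n + 1) * (\<Sum>(y, y')\<in>?A. \<Sum>(a, b)\<in>parcs G. interpolate n (g a) y)"
    unfolding sum_parcs_interpolate[OF assms] sum_distrib_left case_prod_beta ..
  also have "(\<Sum>(y, y')\<in>?A. \<Sum>(a, b)\<in>parcs G. interpolate n (g a) y)
     = (\<Sum>(a, b)\<in>parcs G. \<Sum>(y, y')\<in>?A. interpolate n (g a) y)"
    unfolding case_prod_beta by (rule sum.swap)
  also have "\<dots> = (real n + 1) * (\<Sum>(a, b)\<in>parcs G. \<Sum>(c, d)\<in>parcs G. g a c)"
    unfolding sum_parcs_interpolate[OF assms] sum_distrib_left case_prod_beta ..
  also note bump
  also have "c * ((real n + 1) * ((real n + 1) * (\<Sum>(a, b)\<in>parcs G. \<Sum>(c, d)\<in>parcs G. g a c)))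
      = real n * (real n + 1) * (\<Sum>(a, b)\<in>parcs G. \<Sum>(c, d)\<in>parcs G. g a c)"
    using n by (simp add: c_def)
  finally show ?thesis .
qed

lemma kirchhoff_sum_polygon_step:
  assumes "pair_graph G" "n \<ge> 2" "green_kernel G r g"
  defines "E \<equiv> real (card (edge_set G))" and "N \<equiv> real (card (pverts G))"
  shows "kirchhoff_sum (polygon_step n G) (polygon_green n g)
    = (real n ^ 2 + real n) * kirchhoff_sum G g + 2 / 3 * (real n + 1) * (real n ^ 2 - 1) * E ^ 2
      - 2 / 3 * (real n ^ 2 - 1) * E * N - 1 / 3 * (real n ^ 2 - 1) * (real n - 2) * E"
proof -
  interpret pair_graph G by fact
  have card: "real (card (parcs (polygon_step n G))) = (real n + 1) * (2 * E)" "real (card (parcs G)) = 2 * E"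
    "real (card (oriented_edges G)) = E"
    by (simp_all add: card_parcs_polygon_step[OF assms(1,2)] card_parcs_oriented E_def card_edge_set_oriented algebra_simps)
  show ?thesis
    unfolding kirchhoff_sum_def sum_parcs_polygon_green_diag[OF assms(1-3)] sum_parcs_polygon_green[OF assms(1,2)]
      N_def[symmetric] card
    by (simp add: power2_eq_square field_simps)
qed

section \<open>Iteration\<close>

lemma sum_parcs_base_graph:
  fixes F :: "'a pvert \<Rightarrow> 'a pvert \<Rightarrow> real"
  shows "(\<Sum>(x, y)\<in>parcs (base_graph G). F x y) = (\<Sum>(a, b)\<in>parcs G. F (Base a) (Base b))"
  unfolding base_graph_def by (simp, subst sum.reindex) (auto simp: inj_on_def intro!: sum.cong)

lemma pair_graph_base_graph:
  assumes "pair_graph G"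
  shows "pair_graph (base_graph G)"
proof -
  interpret pair_graph G by fact
  show ?thesis
    by unfold_locales
      (use wellformed' pair_finite_verts pair_finite_arcs arcs_symmetric no_loops' in
        \<open>auto simp: base_graph_def symmetric_def intro!: symI\<close>)
qed

lemma green_kernel_base_graph:
  assumes "green_kernel G r g"
  shows "green_kernel (base_graph G) (Base r) (\<lambda>x y. g (the_inv Base x) (the_inv Base y))"
proof -
  have inv: "the_inv Base (Base a :: 'a pvert) = a" for a :: 'a
    by (rule the_inv_f_f) (simp add: inj_on_def)
  have V: "pverts (base_graph G) = Base ` pverts G" by (simp add: base_graph_def)
  show ?thesis
    using assms by (auto simp: green_kernel_def sum_parcs_base_graph inv V)
qed

lemma kirchhoff_sum_base_graph:
  "kirchhoff_sum (base_graph G) (\<lambda>x y. g (the_inv Base x) (the_inv Base y)) = kirchhoff_sum G g"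
proof -
  have inv: "the_inv Base (Base a :: 'a pvert) = a" for a :: 'a
    by (rule the_inv_f_f) (simp add: inj_on_def)
  have "card (parcs (base_graph G)) = card (parcs G)"
    unfolding base_graph_def by (simp, subst card_image) (auto simp: inj_on_def)
  then show ?thesis
    by (simp add: kirchhoff_sum_def sum_parcs_base_graph inv)
qed

text \<open>
  The Green function is carried along in the induction because the recursion for the Kirchhoff sum consumes
  one at every step. The equation for the number of vertices is multiplied by \<open>n\<close>, which avoids the division in the
  geometric sum \<open>(n - 1) ((n + 1)\<^sup>k - 1) / n\<close>.
\<close>

lemma iterated_polygon_graph_kirchhoff_sum:
  fixes G :: "'a pair_pre_digraph"
  assumes G: "pair_graph G" and n: "n \<ge> 2" and green: "green_kernel G r g" and ne: "parcs G \<noteq> {}"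
  defines "E \<equiv> real (card (edge_set G))" and "N \<equiv> real (card (pverts G))" and "x \<equiv> real n"
  shows "\<exists>r' g'. pair_graph (iterated_polygon_graph n k G)
    \<and> green_kernel (iterated_polygon_graph n k G) r' g'
    \<and> parcs (iterated_polygon_graph n k G) \<noteq> {}
    \<and> real (card (edge_set (iterated_polygon_graph n k G))) = (x + 1) ^ k * E
    \<and> x * real (card (pverts (iterated_polygon_graph n k G))) = x * N + (x - 1) * ((x + 1) ^ k - 1) * E
    \<and> kirchhoff_sum (iterated_polygon_graph n k G) g' =
      (x ^ 2 + x) ^ k * kirchhoff_sum G g
      - 1 / 3 * (x - 2) * (x + 1) ^ k * (x ^ k - 1) * E
      + 2 * (x - 1) / (3 * x) * (x + 1) ^ k
          * ((x + 1) ^ k * (x ^ 2 + 1) - x ^ (k + 2) - 1) * E ^ 2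
      - 2 / 3 * (x + 1) ^ k * (x ^ k - 1) * E * N"
proof (induction k)
  case 0
  interpret G: pair_graph G by fact
  interpret B: pair_graph "base_graph G" by (rule pair_graph_base_graph[OF G])
  have arcs: "card (parcs (base_graph G)) = card (parcs G)"
    unfolding base_graph_def by (simp, subst card_image) (auto simp: inj_on_def)
  have arcs_ne: "parcs (base_graph G) \<noteq> {}"
    using ne by (simp add: base_graph_def)
  have "card (edge_set (base_graph G)) = card (edge_set G)"
    using arcs by (simp add: G.card_edge_set_oriented B.card_edge_set_oriented G.card_parcs_oriented B.card_parcs_oriented)
  moreover have "card (pverts (base_graph G)) = card (pverts G)"
    unfolding base_graph_def by (simp add: card_image inj_on_def)
  ultimately show ?case
    using arcs_ne green_kernel_base_graph[OF green] kirchhoff_sum_base_graph[of G g] B.pair_graph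
    by (auto simp: iterated_polygon_graph_def E_def N_def power2_eq_square intro!: exI)
next
  case (Suc k)
  let ?H = "iterated_polygon_graph n k G"
  obtain r' g' where H: "pair_graph ?H" "green_kernel ?H r' g'" "parcs ?H \<noteq> {}"
    and EH: "real (card (edge_set ?H)) = (x + 1) ^ k * E"
    and NH: "x * real (card (pverts ?H)) = x * N + (x - 1) * ((x + 1) ^ k - 1) * E"
    and KH: "kirchhoff_sum ?H g' = (x ^ 2 + x) ^ k * kirchhoff_sum G g
      - 1 / 3 * (x - 2) * (x + 1) ^ k * (x ^ k - 1) * E
      + 2 * (x - 1) / (3 * x) * (x + 1) ^ k
          * ((x + 1) ^ k * (x ^ 2 + 1) - x ^ (k + 2) - 1) * E ^ 2
      - 2 / 3 * (x + 1) ^ k * (x ^ k - 1) * E * N"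
    using Suc.IH by blast
  have x: "x > 0" using n by (simp add: x_def)
  have step: "iterated_polygon_graph n (Suc k) G = polygon_step n ?H"
    by (simp add: iterated_polygon_graph_def)
  interpret H: pair_graph ?H by (rule H(1))
  interpret T: pair_graph "polygon_step n ?H" by (rule pair_graph_polygon_step[OF H(1) n])
  have "real (card (parcs (polygon_step n ?H))) = (x + 1) * real (card (parcs ?H))"
    by (simp add: card_parcs_polygon_step[OF H(1) n] x_def algebra_simps)
  then have ET: "real (card (edge_set (polygon_step n ?H))) = (x + 1) ^ Suc k * E"
    using EH by (simp add: H.card_edge_set_oriented T.card_edge_set_oriented H.card_parcs_oriented T.card_parcs_oriented)
  have "real (card (pverts (polygon_step n ?H))) = real (card (pverts ?H)) + (x - 1) * ((x + 1) ^ k * E)"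
    using n EH by (simp add: card_pverts_polygon_step[OF H(1) n] H.card_edge_set_oriented x_def)
  then have NT: "x * real (card (pverts (polygon_step n ?H))) = x * N + (x - 1) * ((x + 1) ^ Suc k - 1) * E"
  proof -
    assume *: "real (card (pverts (polygon_step n ?H))) = real (card (pverts ?H)) + (x - 1) * ((x + 1) ^ k * E)"
    have "x * real (card (pverts (polygon_step n ?H)))
        = x * N + (x - 1) * ((x + 1) ^ k - 1) * E + x * ((x - 1) * ((x + 1) ^ k * E))"
      unfolding * distrib_left NH ..
    then show ?thesis by (simp add: algebra_simps)
  qed
  define y where "y = (x + 1) ^ k"
  define z where "z = x ^ k"
  have NH': "real (card (pverts ?H)) = N + (x - 1) * (y - 1) * E / x"
    using NH x by (simp add: y_def field_simps)
  have powers: "(x ^ 2 + x) ^ k = z * y" "(x + 1) ^ Suc k = (x + 1) * y" "x ^ Suc k = x * z"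
    "(x ^ 2 + x) ^ Suc k = (x ^ 2 + x) * (z * y)" "x ^ (k + 2) = x ^ 2 * z" "x ^ (Suc k + 2) = x ^ 3 * z"
    by (simp_all add: y_def z_def power2_eq_square power3_eq_cube power_add algebra_simps flip: power_mult_distrib)
  have "kirchhoff_sum (polygon_step n ?H) (polygon_green n g')
      = (x ^ 2 + x) * kirchhoff_sum ?H g' + 2 / 3 * (x + 1) * (x ^ 2 - 1) * (y * E) ^ 2
      - 2 / 3 * (x ^ 2 - 1) * (y * E) * (N + (x - 1) * (y - 1) * E / x)
      - 1 / 3 * (x ^ 2 - 1) * (x - 2) * (y * E)"
    unfolding kirchhoff_sum_polygon_step[OF H(1) n H(2)] EH NH' x_def[symmetric] y_def[symmetric] ..
  also have "\<dots> = (x ^ 2 + x) ^ Suc k * kirchhoff_sum G g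
      - 1 / 3 * (x - 2) * (x + 1) ^ Suc k * (x ^ Suc k - 1) * E
      + 2 * (x - 1) / (3 * x) * (x + 1) ^ Suc k
          * ((x + 1) ^ Suc k * (x ^ 2 + 1) - x ^ (Suc k + 2) - 1) * E ^ 2
      - 2 / 3 * (x + 1) ^ Suc k * (x ^ Suc k - 1) * E * N"
    unfolding KH powers y_def[symmetric] z_def[symmetric]
    using x by (simp add: divide_simps) (simp add: power2_eq_square power3_eq_cube algebra_simps)
  finally have "kirchhoff_sum (polygon_step n ?H) (polygon_green n g') = \<dots>" .
  moreover have "parcs (polygon_step n ?H) \<noteq> {}"
    using H(3) by (auto simp: polygon_step_def)
  ultimately show ?case
    unfolding step using T.pair_graph green_kernel_polygon_step[OF H(1) n H(2)] ET NT by blast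
qed

theorem theorem5p1:
  fixes G :: "'a pair_pre_digraph" and n N0 E0 :: nat
  assumes "pair_graph G"
    and "Digraph_Component.connected (with_proj G)"
    and "edge_set G \<noteq> {}"
    and "N0 = card (pverts G)"
    and "E0 = card (edge_set G)"
    and "n \<ge> 2"
  shows "degree_kirchhoff_index (polygon_graph n G) =
      (real n ^ 2 + real n) * degree_kirchhoff_index G
      + 2 / 3 * (real n + 1) * (real n ^ 2 - 1) * real E0 ^ 2
      - 2 / 3 * (real n ^ 2 - 1) * real E0 * real N0
      - 1 / 3 * (real n ^ 2 - 1) * (real n - 2) * real E0 \<and>
    (\<forall>g\<ge>1. degree_kirchhoff_index (iterated_polygon_graph n g G) =
      (real n ^ 2 + real n) ^ g * degree_kirchhoff_index G
      - 1 / 3 * (real n - 2) * (real n + 1) ^ g * (real n ^ g - 1) * real E0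
      + 2 * (real n - 1) / (3 * real n) * (real n + 1) ^ g
          * ((real n + 1) ^ g * (real n ^ 2 + 1) - real n ^ (g + 2) - 1) * real E0 ^ 2
      - 2 / 3 * (real n + 1) ^ g * (real n ^ g - 1) * real E0 * real N0)"
proof -
  interpret pair_graph G by fact
  have ne: "parcs G \<noteq> {}" using assms(3) by (auto simp: edge_set_def)
  then obtain r where "r \<in> pverts G" using wellformed' by auto
  then obtain \<Gamma> where \<Gamma>: "green_kernel G r \<Gamma>"
    using connected_green_kernel assms(2) by blast
  have iterate: "degree_kirchhoff_index (iterated_polygon_graph n g G) =
      (real n ^ 2 + real n) ^ g * degree_kirchhoff_index G
      - 1 / 3 * (real n - 2) * (real n + 1) ^ g * (real n ^ g - 1) * real E0
      + 2 * (real n - 1) / (3 * real n) * (real n + 1) ^ g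
          * ((real n + 1) ^ g * (real n ^ 2 + 1) - real n ^ (g + 2) - 1) * real E0 ^ 2
      - 2 / 3 * (real n + 1) ^ g * (real n ^ g - 1) * real E0 * real N0" for g
    using iterated_polygon_graph_kirchhoff_sum[OF assms(1,6) \<Gamma> ne, of g]
      pair_graph.degree_kirchhoff_index_eq_kirchhoff_sum
      degree_kirchhoff_index_eq_kirchhoff_sum[OF \<Gamma> ne] assms(4,5) by metis
  have "polygon_graph n G = iterated_polygon_graph n 1 G"
    by (simp add: polygon_graph_def iterated_polygon_graph_def)
  moreover have coefficient: "2 * (real n - 1) / (3 * real n) * (real n + 1)
      * ((real n + 1) * (real n ^ 2 + 1) - real n ^ (1 + 2) - 1)
      = 2 / 3 * (real n + 1) * (real n ^ 2 - 1)"
  proof -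
    have "real n > 0" using assms(6) by simp
    then show ?thesis by (simp add: divide_simps) (simp add: power2_eq_square power3_eq_cube algebra_simps)
  qed
  ultimately have "degree_kirchhoff_index (polygon_graph n G) =
      (real n ^ 2 + real n) * degree_kirchhoff_index G
      - 1 / 3 * (real n - 2) * (real n + 1) * (real n - 1) * real E0
      + 2 / 3 * (real n + 1) * (real n ^ 2 - 1) * real E0 ^ 2
      - 2 / 3 * (real n + 1) * (real n - 1) * real E0 * real N0"
    using iterate[of 1] by (simp only: power_one_right)
  then have "degree_kirchhoff_index (polygon_graph n G) =
      (real n ^ 2 + real n) * degree_kirchhoff_index G
      + 2 / 3 * (real n + 1) * (real n ^ 2 - 1) * real E0 ^ 2
      - 2 / 3 * (real n ^ 2 - 1) * real E0 * real N0
      - 1 / 3 * (real n ^ 2 - 1) * (real n - 2) * real E0"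
    by (simp add: power2_eq_square algebra_simps add_divide_distrib diff_divide_distrib)
  with iterate show ?thesis by blast
qed

end
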